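(* Let $r\ge 2$ be an integer and let $K=\prod_{i=1}^3(x_i^c-h_i,x_i^c+h_i)\subset\mathbb R^3$ be a box. The following degrees of freedom (DOFs) are unisolvent for the space $\mathcal S^{+,2}_{r-1}(K)$, i.e. their number (after choosing bases of the test spaces) equals $\dim\mathcal S^{+,2}_{r-1}(K)$, and any $\mathbf u\in\mathcal S^{+,2}_{r-1}(K)$ on which all of them vanish is zero: (5) $\int_f\mathbf u\cdot\mathbf n_f\,q\,dA$ for all $q\in P_{r-1}(f)$ and all faces $f$ of $K$; (6) $\int_f(\mathbf u\times\mathbf n_f)\cdot\mathbf q\,dA$ for all $\mathbf q\in[P_{r-2}(f)]^2$ and all faces $f$ of $K$; (7) $\int_K\mathbf u\cdot\mathbf q\,dV$ for all $\mathbf q\in[P_{r-3}(K)]^3$.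
   Context: Conventions: $P_k$ = polynomials of total degree at most $k$, $\widetilde P_k$ = homogeneous polynomials of degree $k$ (both $\{0\}$ if $k<0$). $\mathbf n_f$ is the unit outward normal of the face $f$ of $K$; $[P_k(f)]^2$ is identified with tangential polynomial vector fields on $f$. For a vector $\mathbf a$, $[P_k(K)]^3\times\mathbf a=\{\mathbf p\times\mathbf a:\mathbf p\in[P_k(K)]^3\}$. $(\cdot,\cdot)_K$ is the $L^2(K)$ inner product. $\mathcal S^2_{r-1}(K)=[P_{r-1}(K)]^3+\{\operatorname{curl}(x_2x_3(w_2-w_3),\,x_1x_3(w_3-w_1),\,x_1x_2(w_1-w_2))^{T}\}$, where each $w_i$ ranges over the polynomials in $\widetilde P_{r-1}(K)$ independent of $x_i$. Bubbles: $B_K=\prod_{i=1}^3(x_i-x_i^c+h_i)(x_i^c+h_i-x_i)$, and $B_f=B_K/\lambda_f$, where $\lambda_f$ is the linear factor of $B_K$ vanishing on $f$ (so $\operatorname{grad}\lambda_f=-\mathbf n_f$). $\mathcal V^{r-2}_f(K)=\{\mathbf q\in[P_{r-2}(K)]^3\times\mathbf n_f:(\mathbf q,B_KB_f\mathbf w)_K=0\ \ \forall\,\mathbf w\in[P_{r-3}(K)]^3\times\mathbf n_f\}$, $\mathcal V^{r-2}(K)=B_K\sum_{f}B_f\mathcal V^{r-2}_f(K)$ (sum over the six faces $f$ of $K$), and $\mathcal U^{r-2}(K)=\operatorname{curl}\mathcal V^{r-2}(K)$. $\mathcal S^{+,2}_{r-1}(K)=\mathcal S^2_{r-1}(K)+\mathcal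 U^{r-2}(K)$. *)

theory Defs
  imports "HOL-Analysis.Analysis" "HOL-Library.Function_Algebras"
begin

text \<open>Pointwise vector space structure on functions, so that \<^const>\<open>span\<close> and
  \<^const>\<open>dim\<close> apply to spaces of scalar and vector fields.\<close>

instantiation "fun" :: (type, real_vector) real_vector
begin

definition scaleR_fun :: "real \<Rightarrow> ('a \<Rightarrow> 'b) \<Rightarrow> 'a \<Rightarrow> 'b"
  where "scaleR_fun a u = (\<lambda>x. a *\<^sub>R u x)"

instance
  by standard (auto simp: scaleR_fun_def fun_eq_iff algebra_simps)

end

text \<open>A polynomial on a box is identified with the polynomial function it defines on the whole
  of \<open>\<real>\<^sup>3\<close>. Degrees are integers, so that the spaces are \<open>{0}\<close> for negative degree
  (the span of no monomials).\<close>

definition monomial :: "(3 \<Rightarrow> nat) \<Rightarrow> real^3 \<Rightarrow> real"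
  where "monomial a = (\<lambda>x. \<Prod>i\<in>UNIV. x $ i ^ a i)"

definition poly_le :: "int \<Rightarrow> (real^3 \<Rightarrow> real) set"
  where "poly_le k = span {monomial a | a. int (\<Sum>i\<in>UNIV. a i) \<le> k}"

definition poly_hom :: "int \<Rightarrow> (real^3 \<Rightarrow> real) set"
  where "poly_hom k = span {monomial a | a. int (\<Sum>i\<in>UNIV. a i) = k}"

definition indep_of :: "3 \<Rightarrow> (real^3 \<Rightarrow> real) \<Rightarrow> bool"
  where "indep_of i p \<longleftrightarrow> (\<forall>x y. (\<forall>j. j \<noteq> i \<longrightarrow> x $ j = y $ j) \<longrightarrow> p x = p y)"

definition poly_vec :: "int \<Rightarrow> (real^3 \<Rightarrow> real^3) set"
  where "poly_vec k = {p. \<forall>i. (\<lambda>x. p x $ i) \<in> poly_le k}"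

definition poly_vec_cross :: "int \<Rightarrow> real^3 \<Rightarrow> (real^3 \<Rightarrow> real^3) set"
  where "poly_vec_cross k a = {\<lambda>x. cross3 (p x) a | p. p \<in> poly_vec k}"

definition pderiv3 :: "3 \<Rightarrow> (real^3 \<Rightarrow> real) \<Rightarrow> real^3 \<Rightarrow> real"
  where "pderiv3 i g x = deriv (\<lambda>t. g (x + t *\<^sub>R axis i 1)) 0"

definition curl :: "(real^3 \<Rightarrow> real^3) \<Rightarrow> real^3 \<Rightarrow> real^3"
  where "curl u x = vector
    [pderiv3 2 (\<lambda>y. u y $ 3) x - pderiv3 3 (\<lambda>y. u y $ 2) x,
     pderiv3 3 (\<lambda>y. u y $ 1) x - pderiv3 1 (\<lambda>y. u y $ 3) x,
     pderiv3 1 (\<lambda>y. u y $ 2) x - pderiv3 2 (\<lambda>y. u y $ 1) x]"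

text \<open>The box \<open>K\<close> with centre \<open>c\<close> and half widths \<open>h\<close>. Its six faces are encoded by pairs
  \<open>(i, s)\<close> with \<open>s = 1\<close> or \<open>s = -1\<close>: the side where \<open>x\<^sub>i = c\<^sub>i + s h\<^sub>i\<close>.\<close>

type_synonym face = "3 \<times> real"

definition Kbox :: "real^3 \<Rightarrow> real^3 \<Rightarrow> (real^3) set"
  where "Kbox c h = box (c - h) (c + h)"

definition faces :: "face set"
  where "faces = UNIV \<times> {-1, 1}"

definition face_set :: "real^3 \<Rightarrow> real^3 \<Rightarrow> face \<Rightarrow> (real^3) set"
  where "face_set c h f =
    {x \<in> closure (Kbox c h). x $ fst f = c $ fst f + snd f * h $ fst f}"

definition normal :: "face \<Rightarrow> real^3"
  where "normal f = axis (fst f) (snd f)"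

text \<open>Area integral over a face, using the two remaining coordinates as a (unit speed)
  parametrization. In the index type \<^typ>\<open>3\<close> addition is modulo 3, so for each \<open>i\<close>
  the remaining indices are \<open>i + 1\<close> and \<open>i + 2\<close>.\<close>

definition face_point :: "real^3 \<Rightarrow> real^3 \<Rightarrow> face \<Rightarrow> real \<times> real \<Rightarrow> real^3"
  where "face_point c h f y =
    (\<chi> j. if j = fst f then c $ fst f + snd f * h $ fst f
          else if j = fst f + 1 then fst y else snd y)"

definition face_rect :: "real^3 \<Rightarrow> real^3 \<Rightarrow> face \<Rightarrow> (real \<times> real) set"
  where "face_rect c h f =
    (let j = fst f + 1; k = fst f + 2
     in cbox (c $ j - h $ j, c $ k - h $ k) (c $ j + h $ j, c $ k + h $ k))"

definition face_integral :: "real^3 \<Rightarrow> real^3 \<Rightarrow> face \<Rightarrow> (real^3 \<Rightarrow> real) \<Rightarrow> real"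
  where "face_integral c h f g = integral (face_rect c h f) (\<lambda>y. g (face_point c h f y))"

lemma index3_cases:
  fixes i j :: 3
  shows "j = i \<or> j = i + 1 \<or> j = i + 2" "i + 1 \<noteq> i" "i + 2 \<noteq> i" "i + 2 \<noteq> i + 1"
  using exhaust_3[of i] exhaust_3[of j] by auto

lemma face_point_image:
  assumes "f \<in> faces" and h: "\<forall>i. 0 < h $ i"
  shows "face_point c h f ` face_rect c h f = face_set c h f"
proof -
  obtain i s where f: "f = (i, s)" and s: "s = -1 \<or> s = 1"
    using assms(1) by (auto simp: faces_def)
  have fs: "fst f = i" "snd f = s"
    by (simp_all add: f)
  have ne: "box (c - h) (c + h) \<noteq> {}"
    using h by (auto simp: box_ne_empty Basis_vec_def inner_axis)
  have all: "(\<forall>j. P j) \<longleftrightarrow> P i \<and> P (i + 1) \<and> P (i + 2)" for P :: "3 \<Rightarrow> bool"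
    using index3_cases(1)[of _ i] by metis
  have set: "face_set c h f = {x. x $ i = c $ i + s * h $ i \<and>
      c $ (i+1) - h $ (i+1) \<le> x $ (i+1) \<and> x $ (i+1) \<le> c $ (i+1) + h $ (i+1) \<and>
      c $ (i+2) - h $ (i+2) \<le> x $ (i+2) \<and> x $ (i+2) \<le> c $ (i+2) + h $ (i+2)}"
    using s h[rule_format, of i]
    unfolding face_set_def Kbox_def closure_box[OF ne] mem_box_cart f all by auto
  have rect: "face_rect c h f = {y. c $ (i+1) - h $ (i+1) \<le> fst y \<and> fst y \<le> c $ (i+1) + h $ (i+1) \<and>
      c $ (i+2) - h $ (i+2) \<le> snd y \<and> snd y \<le> c $ (i+2) + h $ (i+2)}"
    by (auto simp: face_rect_def f Let_def cbox_Pair_eq)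
  show ?thesis
  proof (intro set_eqI iffI)
    fix x assume "x \<in> face_point c h f ` face_rect c h f"
    then show "x \<in> face_set c h f"
      by (auto simp: set rect face_point_def fs index3_cases)
  next
    fix x assume x: "x \<in> face_set c h f"
    have "x = face_point c h f (x $ (i+1), x $ (i+2))"
      using x by (simp add: vec_eq_iff all set face_point_def fs index3_cases)
    moreover have "(x $ (i+1), x $ (i+2)) \<in> face_rect c h f"
      using x by (simp add: set rect)
    ultimately show "x \<in> face_point c h f ` face_rect c h f" by blast
  qed
qed

text \<open>Polynomials on a face are identified with polynomials in the two tangential coordinates,
  extended to \<open>\<real>\<^sup>3\<close> constantly in the normal direction.\<close>

definition poly_face :: "int \<Rightarrow> face \<Rightarrow> (real^3 \<Rightarrow> real) set"
  where "poly_face k f = {q \<in> poly_le k. indep_of (fst f) q}"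

definition poly_face_tangential :: "int \<Rightarrow> face \<Rightarrow> (real^3 \<Rightarrow> real^3) set"
  where "poly_face_tangential k f =
    {q. (\<forall>j. (\<lambda>x. q x $ j) \<in> poly_face k f) \<and> (\<forall>x. q x \<bullet> normal f = 0)}"

definition L2_inner :: "real^3 \<Rightarrow> real^3 \<Rightarrow> (real^3 \<Rightarrow> real^3) \<Rightarrow> (real^3 \<Rightarrow> real^3) \<Rightarrow> real"
  where "L2_inner c h u v = integral (Kbox c h) (\<lambda>x. u x \<bullet> v x)"

definition S2 :: "int \<Rightarrow> (real^3 \<Rightarrow> real^3) set"
  where "S2 k =
    {p + curl (\<lambda>x. vector [x$2 * x$3 * (w 2 x - w 3 x),
                           x$1 * x$3 * (w 3 x - w 1 x),
                           x$1 * x$2 * (w 1 x - w 2 x)]) | p w.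
     p \<in> poly_vec k \<and> (\<forall>i::3. w i \<in> poly_hom k \<and> indep_of i (w i))}"

definition bubble_K :: "real^3 \<Rightarrow> real^3 \<Rightarrow> real^3 \<Rightarrow> real"
  where "bubble_K c h x = (\<Prod>i\<in>UNIV. (x$i - c$i + h$i) * (c$i + h$i - x$i))"

definition face_factor :: "real^3 \<Rightarrow> real^3 \<Rightarrow> face \<Rightarrow> real^3 \<Rightarrow> real"
  where "face_factor c h f x = h $ fst f - snd f * (x $ fst f - c $ fst f)"

text \<open>The polynomial \<open>B\<^sub>f = B\<^sub>K / \<lambda>\<^sub>f\<close>, written as the product of the five other linear
  factors because pointwise division would give \<open>0\<close> on the face \<open>f\<close> itself.\<close>

definition bubble_face :: "real^3 \<Rightarrow> real^3 \<Rightarrow> face \<Rightarrow> real^3 \<Rightarrow> real"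
  where "bubble_face c h f x = (\<Prod>g\<in>faces - {f}. face_factor c h g x)"

lemma bubble_K_eq_face_factor_mult_bubble_face:
  assumes "f \<in> faces"
  shows "bubble_K c h x = face_factor c h f x * bubble_face c h f x"
proof -
  have "bubble_K c h x = (\<Prod>i\<in>UNIV. \<Prod>s\<in>{-1, 1}. face_factor c h (i, s) x)"
    by (simp add: bubble_K_def face_factor_def algebra_simps)
  also have "\<dots> = (\<Prod>g\<in>faces. face_factor c h g x)"
    unfolding faces_def prod.cartesian_product by (simp add: case_prod_beta)
  also have "\<dots> = face_factor c h f x * bubble_face c h f x"
    using assms unfolding bubble_face_def by (intro prod.remove) (auto simp: faces_def)
  finally show ?thesis .
qed

definition V_face :: "real^3 \<Rightarrow> real^3 \<Rightarrow> int \<Rightarrow> face \<Rightarrow> (real^3 \<Rightarrow> real^3) set"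
  where "V_face c h k f =
    {q \<in> poly_vec_cross k (normal f). \<forall>w \<in> poly_vec_cross (k - 1) (normal f).
       L2_inner c h q (\<lambda>x. (bubble_K c h x * bubble_face c h f x) *\<^sub>R w x) = 0}"

definition V_space :: "real^3 \<Rightarrow> real^3 \<Rightarrow> int \<Rightarrow> (real^3 \<Rightarrow> real^3) set"
  where "V_space c h k =
    {\<lambda>x. bubble_K c h x *\<^sub>R (\<Sum>f\<in>faces. bubble_face c h f x *\<^sub>R q f x) | q.
     \<forall>f\<in>faces. q f \<in> V_face c h k f}"

definition U_space :: "real^3 \<Rightarrow> real^3 \<Rightarrow> int \<Rightarrow> (real^3 \<Rightarrow> real^3) set"
  where "U_space c h k = curl ` V_space c h k"

definition S2_plus :: "real^3 \<Rightarrow> real^3 \<Rightarrow> int \<Rightarrow> (real^3 \<Rightarrow> real^3) set"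
  where "S2_plus c h k = {u + v | u v. u \<in> S2 k \<and> v \<in> U_space c h (k - 1)}"

end

theory Submission
  imports Defs
begin

text \<open>
  Why the degrees of freedom determine a field. Write \<open>u = s + curl v\<close> with \<open>s\<close> in the serendipity space
  and \<open>v = B\<^sub>K \<Sum>\<^sub>f B\<^sub>f q\<^sub>f\<close>. The normal and interior degrees of freedom do not see \<open>curl v\<close>. The normal
  component of \<open>curl v\<close> on a face involves only tangential derivatives of \<open>v\<close>, and \<open>v\<close> vanishes on the
  boundary (\<open>curl_bubble_normal_trace\<close>). Against \<open>g\<close> of degree \<open>r - 3\<close>, integration by parts moves the
  curl onto \<open>g\<close>, and the weighted orthogonality that defines the spaces \<open>V\<^sub>f\<close> makes every summand
  vanish (\<open>curl_bubble_orthogonal\<close>). So \<open>s\<close> alone has vanishing normal and interior moments.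

  The curl that defines the serendipity space equals \<open>x\<^sub>i ((r + 2) w\<^sub>i - w\<^sub>1 - w\<^sub>2 - w\<^sub>3)\<close> in component \<open>i\<close>,
  by Euler's identity. On a face orthogonal to \<open>e\<^sub>i\<close> the factor \<open>x\<^sub>i\<close> is constant, so the normal component
  of \<open>s\<close> is a polynomial of degree \<open>r - 1\<close> there, can serve as its own test function, and is
  zero. Comparing two opposite faces in the top degree shows that the second factor vanishes for
  \<open>x\<^sub>i = 0\<close>; for the three \<open>i\<close> together this forces \<open>w = 0\<close> (\<open>hom_triples_zero\<close>). What is left is a
  polynomial field whose component \<open>i\<close> is divisible by the two linear factors of the faces orthogonal to
  \<open>e\<^sub>i\<close>, with a quotient of degree \<open>r - 3\<close>, and the interior moments against these quotients give
  \<open>s = 0\<close> (\<open>serendipity_unisolvent\<close>).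

  For the remaining part, the tangential trace of \<open>curl v\<close> on \<open>f\<close> is \<open>- B\<^sub>f\<^sup>2 q\<^sub>f\<close>: the derivative has to hit
  the factor of \<open>B\<^sub>K\<close> that vanishes on \<open>f\<close>, and the other \<open>B\<^sub>g\<close> are zero there. Testing with \<open>q\<^sub>f\<close> itself
  gives \<open>q\<^sub>f = 0\<close> on \<open>f\<close>, so \<open>q\<^sub>f = \<lambda>\<^sub>f w\<close>, and orthogonality against \<open>w\<close> becomes
  \<open>\<integral> B\<^sub>K\<^sup>2 |w|\<^sup>2 = 0\<close> (\<open>V_face_trace_inj\<close>).

  Dimensions. The same arguments, applied to \<open>u = 0\<close>, show that all sums are direct and that the
  bubble coefficients parametrize the bubble space injectively. The trace on \<open>f\<close> maps \<open>V\<^sub>f\<close> onto the tangential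
  polynomials of degree \<open>r - 2\<close>, because subtracting the projection of a given extension onto
  \<open>\<lambda>\<^sub>f [P\<^sub>r\<^sub>-\<^sub>3]\<^sup>3 \<times> n\<^sub>f\<close> does not change its trace (\<open>V_face_trace_surj\<close>). For the serendipity space, with
  \<open>P\<^sup>i\<close> and \<open>H\<^sup>i\<close> the polynomials and the forms that do not depend on \<open>x\<^sub>i\<close>, the count reduces to
  \<open>dim P\<^sub>m + dim H\<^sup>i\<^sub>m = 2 dim P\<^sup>i\<^sub>m + dim P\<^sub>m\<^sub>-\<^sub>2\<close> for \<open>m = r - 1\<close>, which follows from the splittings
  \<open>P\<^sub>m = P\<^sup>i\<^sub>m \<oplus> x\<^sub>i P\<^sub>m\<^sub>-\<^sub>1\<close> and \<open>P\<^sup>i\<^sub>m = P\<^sup>i\<^sub>m\<^sub>-\<^sub>1 \<oplus> H\<^sup>i\<^sub>m\<close> (\<open>dim_poly_le_add_hom\<close>).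
\<close>

section \<open>Finite-dimensional subspaces\<close>

text \<open>Spaces of functions are not finite-dimensional as types, so finite dimension is a property of the
  subspace at hand.\<close>

definition fin_dim :: "'a::real_vector set \<Rightarrow> bool"
  where "fin_dim S \<longleftrightarrow> (\<exists>B. finite B \<and> S = span B)"

lemma fin_dim_imp_subspace: "fin_dim S \<Longrightarrow> subspace S"
  by (auto simp: fin_dim_def)

lemma subspace_of_fin_dim:
  assumes "fin_dim S" "subspace T" "T \<subseteq> S"
  obtains B where "finite B" "independent B" "span B = T" "card B = dim T"
proof -
  obtain B where B: "B \<subseteq> T" "independent B" "T \<subseteq> span B" "card B = dim T"
    using basis_exists by blast
  obtain C where "finite C" "S = span C"
    using assms(1) by (auto simp: fin_dim_def)
  then have "finite B"
    using independent_span_bound[of C B] B assms(3) by auto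
  moreover have "span B = T"
    using B assms(2) by (simp add: span_minimal subset_antisym)
  ultimately show ?thesis using B that by blast
qed

lemma fin_dim_subset: "fin_dim S \<Longrightarrow> subspace T \<Longrightarrow> T \<subseteq> S \<Longrightarrow> fin_dim T"
  by (metis subspace_of_fin_dim fin_dim_def)

lemma fin_dim_basis:
  assumes "fin_dim S"
  obtains B where "finite B" "independent B" "span B = S" "card B = dim S"
  using subspace_of_fin_dim[OF assms fin_dim_imp_subspace[OF assms]] by blast

text \<open>The map is only required to be linear on \<open>S\<close>: the curl takes arbitrary values where partial
  derivatives do not exist, so it is linear on polynomial fields but not on all functions. The proof replaces the map by the linear map that agrees with it on a basis of \<open>S\<close>.\<close>

lemma dim_image_inj_on_subspace:
  fixes T :: "'a::real_vector \<Rightarrow> 'b::real_vector"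
  assumes S: "fin_dim S"
    and add: "\<And>x y. x \<in> S \<Longrightarrow> y \<in> S \<Longrightarrow> T (x + y) = T x + T y"
    and scale: "\<And>a x. x \<in> S \<Longrightarrow> T (a *\<^sub>R x) = a *\<^sub>R T x"
    and inj: "\<And>x. x \<in> S \<Longrightarrow> T x = 0 \<Longrightarrow> x = 0"
  shows "fin_dim (T ` S)" and "dim (T ` S) = dim S"
proof -
  obtain B where B: "finite B" "independent B" "span B = S" "card B = dim S"
    using fin_dim_basis[OF S] .
  define L where "L = real_vector.construct B T"
  have L: "linear L"
    unfolding L_def using B(2) by (rule linear_construct)
  have "x \<in> S \<and> L x = T x" if "x \<in> span B" for x
    using that
  proof (induction rule: span_induct_alt)
    case base
    then show ?case
      using scale[of 0 0] linear_0[OF L] subspace_0[OF fin_dim_imp_subspace[OF S]] by simp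
  next
    case (step c x y)
    then have "L x = T x"
      by (simp add: L_def construct_basis[OF B(2)])
    moreover have "x \<in> S" "c *\<^sub>R x \<in> S" "c *\<^sub>R x + y \<in> S"
      using step B(3) by (auto simp: span_base span_scale span_add)
    ultimately show ?case
      using step linear_add[OF L] linear_scale[OF L] add scale by simp
  qed
  then have eq: "L x = T x" if "x \<in> S" for x
    using that B(3) by blast
  have inj': "inj_on L (span B)"
    unfolding linear_inj_on_iff_eq_0[OF L subspace_span] using inj eq B(3) by auto
  have img: "T ` S = span (L ` B)"
    using linear_span_image[OF L] eq B(3) by (metis image_cong)
  have ind: "independent (L ` B)"
    using linear_independent_injective_image[OF L B(2) inj'] .
  show "fin_dim (T ` S)"
    using img B(1) by (auto simp: fin_dim_def)
  have "card (L ` B) = card B"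
    using inj' by (metis card_image inj_on_subset span_superset)
  then show "dim (T ` S) = dim S"
    using img ind B(4) dim_span_eq_card_independent[OF ind] by simp
qed

lemma dim_direct_sum:
  assumes A: "fin_dim A" and B: "fin_dim B" and AB: "A \<inter> B \<subseteq> {0}"
  shows "fin_dim {a + b | a b. a \<in> A \<and> b \<in> B}"
    and "dim {a + b | a b. a \<in> A \<and> b \<in> B} = dim A + dim B"
proof -
  obtain A' where A': "finite A'" "independent A'" "span A' = A" "card A' = dim A"
    using fin_dim_basis[OF A] .
  obtain B' where B': "finite B'" "independent B'" "span B' = B" "card B' = dim B"
    using fin_dim_basis[OF B] .
  have sum: "{a + b | a b. a \<in> A \<and> b \<in> B} = span (A' \<union> B')"
    by (auto simp: span_Un A' B')
  have disj: "A' \<inter> B' = {}"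
    using A' B' AB dependent_zero span_superset by (metis disjoint_iff_not_equal insertE
        IntI empty_iff subsetD)
  have ind: "independent (A' \<union> B')"
  proof (rule independent_if_scalars_zero)
    fix f x assume 0: "(\<Sum>x\<in>A' \<union> B'. f x *\<^sub>R x) = 0" and x: "x \<in> A' \<union> B'"
    let ?a = "\<Sum>x\<in>A'. f x *\<^sub>R x" and ?b = "\<Sum>x\<in>B'. f x *\<^sub>R x"
    have ab: "?a + ?b = 0"
      using 0 disj A'(1) B'(1) by (simp add: sum.union_disjoint)
    have "?a \<in> A" "?b \<in> B"
      unfolding A'(3)[symmetric] B'(3)[symmetric] 
      by (auto intro: span_sum span_scale span_base)
    moreover have "?a = - ?b"
      using ab by (simp add: eq_neg_iff_add_eq_0)
    ultimately have "?a = 0" "?b = 0"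
      using AB fin_dim_imp_subspace[OF B] subspace_neg by force+
    then show "f x = 0"
      using x independentD[OF A'(2,1) subset_refl] independentD[OF B'(2,1) subset_refl] by blast
  qed (use A' B' in auto)
  show "fin_dim {a + b | a b. a \<in> A \<and> b \<in> B}"
    using sum A' B' by (auto simp: fin_dim_def)
  show "dim {a + b | a b. a \<in> A \<and> b \<in> B} = dim A + dim B"
    unfolding sum dim_span_eq_card_independent[OF ind]
    using A' B' disj by (simp add: card_Un_disjoint)
qed

text \<open>The direct product of the \<open>S i\<close>, realized inside a function space; the value 0 outside \<open>I\<close> makes
  the representation unique.\<close>

definition prod_space :: "'i set \<Rightarrow> ('i \<Rightarrow> 'a::real_vector set) \<Rightarrow> ('i \<Rightarrow> 'a) set"
  where "prod_space I S = {q. (\<forall>i\<in>I. q i \<in> S i) \<and> (\<forall>i. i \<notin> I \<longrightarrow> q i = 0)}"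

lemma scaleR_fun_apply [simp]: "(a *\<^sub>R u) x = a *\<^sub>R u x"
  by (simp add: scaleR_fun_def)

lemma dim_prod_space:
  fixes S :: "'i \<Rightarrow> 'a::real_vector set"
  assumes "finite I" and "\<And>i. i \<in> I \<Longrightarrow> fin_dim (S i)"
  shows "fin_dim (prod_space I S) \<and> dim (prod_space I S) = (\<Sum>i\<in>I. dim (S i))"
  using assms
proof (induction I rule: finite_induct)
  case empty
  have "prod_space {} S = span {}"
    by (auto simp: prod_space_def)
  then show ?case
    using dim_span_eq_card_independent[of "{} :: ('i \<Rightarrow> 'a) set"]
    by (auto simp: fin_dim_def independent_empty simp del: span_empty)
next
  case (insert i I)
  define T where "T v = (\<lambda>j. if j = i then v else 0)" for v :: 'a
  have T: "fin_dim (T ` S i)" "dim (T ` S i) = dim (S i)"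
    using insert.prems
    by (auto intro!: dim_image_inj_on_subspace simp: T_def fun_eq_iff split: if_splits)
  have P: "fin_dim (prod_space I S)" "dim (prod_space I S) = (\<Sum>i\<in>I. dim (S i))"
    using insert by auto
  have "T ` S i \<inter> prod_space I S \<subseteq> {0}"
    using insert.hyps by (fastforce simp: T_def prod_space_def fun_eq_iff)
  note sum = dim_direct_sum[OF T(1) P(1) this]
  have "{a + b | a b. a \<in> T ` S i \<and> b \<in> prod_space I S} = prod_space (insert i I) S"
  proof (intro set_eqI iffI)
    fix q assume "q \<in> prod_space (insert i I) S"
    then have "q = T (q i) + q(i := 0)" "T (q i) \<in> T ` S i" "q(i := 0) \<in> prod_space I S"
      using insert.hyps by (auto simp: T_def prod_space_def)
    then show "q \<in> {a + b | a b. a \<in> T ` S i \<and> b \<in> prod_space I S}"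
      by blast
  qed (use insert.hyps in \<open>auto simp: T_def prod_space_def\<close>)
  then show ?case
    using sum T P insert.hyps by simp
qed

text \<open>Riesz representation on a finite-dimensional space: by induction over a spanning set, in which the new
  vector is replaced by its component orthogonal to the span of the old ones. It serves to construct
  orthogonal projections with respect to a weighted inner product.\<close>

lemma bilinear_representation:
  fixes \<beta> :: "'a::real_vector \<Rightarrow> 'a \<Rightarrow> real" and \<phi> :: "'a \<Rightarrow> real"
  assumes S: "fin_dim S"
    and \<phi>: "\<And>x y. x \<in> S \<Longrightarrow> y \<in> S \<Longrightarrow> \<phi> (x + y) = \<phi> x + \<phi> y"
      "\<And>a x. x \<in> S \<Longrightarrow> \<phi> (a *\<^sub>R x) = a * \<phi> x"
    and \<beta>: "\<And>x y z. x \<in> S \<Longrightarrow> y \<in> S \<Longrightarrow> z \<in> S \<Longrightarrow> \<beta> (x + y) z = \<beta> x z + \<beta> y z"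
      "\<And>a x z. x \<in> S \<Longrightarrow> z \<in> S \<Longrightarrow> \<beta> (a *\<^sub>R x) z = a * \<beta> x z"
    and sym: "\<And>x y. x \<in> S \<Longrightarrow> y \<in> S \<Longrightarrow> \<beta> x y = \<beta> y x"
    and def: "\<And>x. x \<in> S \<Longrightarrow> \<beta> x x = 0 \<Longrightarrow> x = 0"
  obtains w where "w \<in> S" "\<And>x. x \<in> S \<Longrightarrow> \<beta> w x = \<phi> x"
proof -
  obtain B where B: "finite B" "S = span B"
    using S by (auto simp: fin_dim_def)
  have \<beta>r: "\<beta> z (x + y) = \<beta> z x + \<beta> z y" "\<beta> z (a *\<^sub>R x) = a * \<beta> z x"
    if "x \<in> S" "y \<in> S" "z \<in> S" for x y z a
    using that \<beta> sym fin_dim_imp_subspace[OF S] subspace_add subspace_scale by metis+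
  have "\<exists>w\<in>span C. \<forall>x\<in>span C. \<beta> w x = \<psi> x"
    if "finite C" "C \<subseteq> S"
      and "\<And>x y. x \<in> S \<Longrightarrow> y \<in> S \<Longrightarrow> \<psi> (x + y) = \<psi> x + \<psi> y"
      and "\<And>a x. x \<in> S \<Longrightarrow> \<psi> (a *\<^sub>R x) = a * \<psi> x" for C \<psi>
    using that
  proof (induction C arbitrary: \<psi> rule: finite_induct)
    case empty
    have "0 \<in> S" by (simp add: B span_zero)
    then have "\<psi> 0 = 0" "\<beta> 0 0 = 0"
      using empty(3)[of 0 0] \<beta>(2)[of 0 0 0] by auto
    then show ?case by simp
  next
    case (insert b C)
    have C: "span C \<subseteq> S" and b: "b \<in> S"
      using insert.prems B by (auto simp: span_minimal)
    have sub: "subspace S" using B by simp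
    obtain w where w: "w \<in> span C" "\<forall>x\<in>span C. \<beta> w x = \<psi> x"
      using insert.IH[of \<psi>] insert.prems by auto
    \<comment> \<open>\<open>e\<close> is the component of \<open>b\<close> orthogonal to \<open>span C\<close>\<close>
    obtain d where d: "d \<in> span C" "\<forall>x\<in>span C. \<beta> d x = \<beta> b x"
      using insert.IH[of "\<beta> b"] insert.prems \<beta>r b by auto
    define e where "e = b - d"
    have dS: "d \<in> S" and wS: "w \<in> S" using d w C by auto
    have bde: "b = d + e" by (simp add: e_def)
    have eS: "e \<in> S" using b dS sub by (simp add: e_def subspace_diff)
    have ex: "\<beta> e x = 0" if "x \<in> span C" for x
      using \<beta>(1)[of d e x] that C dS eS d by (auto simp: bde[symmetric])
    have span: "span (insert b C) \<subseteq> {x + a *\<^sub>R e | x a. x \<in> span C}"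
    proof
      fix y assume "y \<in> span (insert b C)"
      then obtain a where "y - a *\<^sub>R b \<in> span C"
        by (auto simp: span_insert)
      then have "(y - a *\<^sub>R b) + a *\<^sub>R d \<in> span C"
        using d by (simp add: span_add span_scale)
      moreover have "y = ((y - a *\<^sub>R b) + a *\<^sub>R d) + a *\<^sub>R e"
        by (simp add: e_def algebra_simps)
      ultimately show "y \<in> {x + a *\<^sub>R e | x a. x \<in> span C}" by blast
    qed
    have ein: "e \<in> span (insert b C)"
      unfolding e_def using d span_mono[of C "insert b C"]
      by (intro span_diff) (auto intro: span_base)
    \<comment> \<open>If \<open>\<beta> e e = 0\<close> then \<open>e = 0\<close> and \<open>\<psi> e = 0\<close>, so the value \<open>0 / 0 = 0\<close> is right as well.\<close>
    define a where "a = \<psi> e / \<beta> e e"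
    have "\<beta> (w + a *\<^sub>R e) y = \<psi> y" if yC: "y \<in> span (insert b C)" for y
    proof -
      obtain x k where y: "y = x + k *\<^sub>R e" and x: "x \<in> span C"
        using yC span by blast
      have xS: "x \<in> S" using x C by auto
      have keS: "k *\<^sub>R e \<in> S" "a *\<^sub>R e \<in> S" "y \<in> S"
        using eS xS sub y by (auto simp: subspace_scale subspace_add)
      have ae: "a * \<beta> e e = \<psi> e"
        using def[OF eS] insert.prems(3)[of e 0] eS by (cases "\<beta> e e = 0") (auto simp: a_def)
      have we: "\<beta> w e = 0"
        using ex[OF w(1)] sym wS eS by simp
      have "\<beta> (w + a *\<^sub>R e) y = \<beta> w y + a * \<beta> e y"
        using \<beta>(1)[OF wS keS(2,3)] \<beta>(2)[OF eS keS(3)] by simp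
      also have "\<dots> = \<psi> x + a * (k * \<beta> e e)"
        using \<beta>r(1)[OF xS keS(1) wS] \<beta>r(2)[OF eS eS wS] \<beta>r(1)[OF xS keS(1) eS]
          \<beta>r(2)[OF eS eS eS] w(2) x ex[OF x] we by (simp add: y)
      also have "\<dots> = \<psi> y"
        using insert.prems(2)[OF xS keS(1)] insert.prems(3)[OF eS] ae by (simp add: y mult.left_commute)
      finally show ?thesis .
    qed
    moreover have "w + a *\<^sub>R e \<in> span (insert b C)"
      using w(1) ein span_mono[of C "insert b C"] by (intro span_add span_scale) auto
    ultimately show ?case by blast
  qed
  from this[OF B(1) _ \<phi>] that show ?thesis
    using B(2) span_superset by metis
qed

section \<open>Polynomial functions\<close>

lemma plus_fun_eq: "p + q = (\<lambda>x. p x + q x)"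
  by (simp add: fun_eq_iff)

text \<open>Every linear fact about polynomials of bounded degree or about forms reduces to monomials by this rule.\<close>

lemma poly_span_induct [consumes 1, case_names zero step]:
  assumes "p \<in> span {monomial a | a. Q a}"
    and "P (\<lambda>x. 0)"
    and "\<And>c a q. Q a \<Longrightarrow> P q \<Longrightarrow> P (\<lambda>x. c * monomial a x + q x)"
  shows "P p"
  using assms(1)
proof (induction rule: span_induct_alt)
  case base
  then show ?case using assms(2) by (simp add: zero_fun_def)
next
  case (step c x y)
  then obtain a where a: "x = monomial a" "Q a" by blast
  have "P (\<lambda>z. c * monomial a z + y z)" using assms(3) a step by blast
  then show ?case by (simp add: a(1) plus_fun_eq scaleR_fun_def)
qed

lemmas poly_le_induct [consumes 1, case_names zero step] =
  poly_span_induct[where Q = "\<lambda>a. int (sum a UNIV) \<le> k" for k, folded poly_le_def]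
lemmas poly_hom_induct [consumes 1, case_names zero step] =
  poly_span_induct[where Q = "\<lambda>a. int (sum a UNIV) = k" for k, folded poly_hom_def]

lemma subspace_poly_le: "subspace (poly_le k)"
  by (simp add: poly_le_def)

lemma subspace_poly_hom: "subspace (poly_hom k)"
  by (simp add: poly_hom_def)

lemma subspace_real_fun:
  fixes S :: "('a \<Rightarrow> real) set"
  assumes "subspace S"
  shows "(\<lambda>x. 0) \<in> S"
    "\<And>p q. p \<in> S \<Longrightarrow> q \<in> S \<Longrightarrow> (\<lambda>x. p x + q x) \<in> S"
    "\<And>p q. p \<in> S \<Longrightarrow> q \<in> S \<Longrightarrow> (\<lambda>x. p x - q x) \<in> S"
    "\<And>p c. p \<in> S \<Longrightarrow> (\<lambda>x. c * p x) \<in> S"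
    "\<And>p c. p \<in> S \<Longrightarrow> (\<lambda>x. - p x) \<in> S"
proof -
  show "(\<lambda>x. 0) \<in> S"
    using subspace_0[OF assms] by (simp add: zero_fun_def)
  show "(\<lambda>x. p x + q x) \<in> S" if "p \<in> S" "q \<in> S" for p q
    using subspace_add[OF assms that] by (simp add: plus_fun_eq)
  show *: "(\<lambda>x. c * p x) \<in> S" if "p \<in> S" for p c
    using subspace_scale[OF assms that, of c] by (simp add: scaleR_fun_def)
  show "(\<lambda>x. p x - q x) \<in> S" if "p \<in> S" "q \<in> S" for p q
    using subspace_diff[OF assms that] by (simp add: fun_diff_def)
  show "(\<lambda>x. - p x) \<in> S" if "p \<in> S" for p c
    using *[OF that, of "-1"] by simp
qed

lemmas poly_le_closed = subspace_real_fun[OF subspace_poly_le]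
lemmas poly_hom_closed = subspace_real_fun[OF subspace_poly_hom]

lemma poly_le_sum: "(\<And>i. i \<in> I \<Longrightarrow> p i \<in> poly_le k) \<Longrightarrow> (\<lambda>x. \<Sum>i\<in>I. p i x) \<in> poly_le k"
  by (induction I rule: infinite_finite_induct) (auto intro: poly_le_closed)

lemma monomial_in_poly_le: "int (sum a UNIV) \<le> k \<Longrightarrow> monomial a \<in> poly_le k"
  unfolding poly_le_def by (rule span_base) auto

lemma monomial_in_poly_hom: "int (sum a UNIV) = k \<Longrightarrow> monomial a \<in> poly_hom k"
  unfolding poly_hom_def by (rule span_base) auto

lemma poly_le_mono: "p \<in> poly_le j \<Longrightarrow> j \<le> k \<Longrightarrow> p \<in> poly_le k"
  unfolding poly_le_def by (rule subsetD[OF span_mono]) auto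

lemma poly_le_neg:
  assumes "p \<in> poly_le k" "k < 0"
  shows "p = (\<lambda>x. 0)"
  using assms
proof (induction rule: poly_le_induct)
  case (step c a q)
  then show ?case using of_nat_0_le_iff[of "sum a UNIV"] by linarith
qed simp

lemma poly_hom_le: "p \<in> poly_hom k \<Longrightarrow> p \<in> poly_le k"
  unfolding poly_le_def poly_hom_def by (rule subsetD[OF span_mono]) auto

lemma monomial_mult: "monomial a x * monomial b x = monomial (\<lambda>i. a i + b i) x"
  by (simp add: monomial_def power_add prod.distrib)

lemma const_in_poly_le: "0 \<le> k \<Longrightarrow> (\<lambda>x. c) \<in> poly_le k"
  using poly_le_closed(4)[OF monomial_in_poly_le[of "\<lambda>i. 0" k], of c] by (simp add: monomial_def)

lemma coord_in_poly_le: "1 \<le> k \<Longrightarrow> (\<lambda>x. x $ i) \<in> poly_le k"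
proof -
  assume "1 \<le> k"
  have "(\<lambda>x. x $ i) = monomial (\<lambda>j. if j = i then 1 else 0)"
    by (simp add: monomial_def fun_eq_iff if_distrib cong: if_cong)
  then show ?thesis using \<open>1 \<le> k\<close> by (auto intro!: monomial_in_poly_le)
qed

lemma poly_le_mult:
  assumes "p \<in> poly_le j" "q \<in> poly_le k"
  shows "(\<lambda>x. p x * q x) \<in> poly_le (j + k)"
  using assms(1)
proof (induction rule: poly_le_induct)
  case (step c a p)
  have "(\<lambda>x. monomial a x * q x) \<in> poly_le (j + k)"
    using assms(2)
  proof (induction rule: poly_le_induct)
    case (step d b q)
    have "monomial (\<lambda>i. a i + b i) \<in> poly_le (j + k)"
      using \<open>int (sum a UNIV) \<le> j\<close> step by (intro monomial_in_poly_le) (simp add: sum.distrib)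
    then have "(\<lambda>x. d * monomial (\<lambda>i. a i + b i) x + monomial a x * q x) \<in> poly_le (j + k)"
      using step by (intro poly_le_closed)
    then show ?case
      by (simp add: monomial_mult[symmetric] algebra_simps)
  qed (simp add: poly_le_closed)
  then have "(\<lambda>x. c * (monomial a x * q x) + p x * q x) \<in> poly_le (j + k)"
    using step by (intro poly_le_closed)
  then show ?case by (simp add: algebra_simps)
qed (simp add: poly_le_closed)

lemma coord_mult_poly_le: "p \<in> poly_le (k - 1) \<Longrightarrow> (\<lambda>x. x $ i * p x) \<in> poly_le k"
  using poly_le_mult[OF coord_in_poly_le[of 1 i], of p "k - 1"] by simp

lemma real_polynomial_function_coord [intro]:
  "real_polynomial_function (\<lambda>x::real^3. x $ i)"
  by (simp add: bounded_linear_vec_nth real_polynomial_function.intros)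

lemma real_polynomial_function_monomial [intro]: "real_polynomial_function (monomial a)"
  unfolding monomial_def
  by (intro real_polynomial_function_prod real_polynomial_function_power) auto

lemma poly_le_imp_real_polynomial_function:
  assumes "p \<in> poly_le k"
  shows "real_polynomial_function p"
  using assms
  by (induction rule: poly_le_induct)
    (rule real_polynomial_function.intros(2),
      intro real_polynomial_function.intros(2-) real_polynomial_function_monomial)

text \<open>Links polynomials with a degree bound to the polynomial functions of the library, for which
  continuity and differentiability are known.\<close>

lemma real_polynomial_function_imp_poly_le:
  fixes p :: "real^3 \<Rightarrow> real"
  assumes "real_polynomial_function p"
  shows "\<exists>k. p \<in> poly_le k"
  using assms
proof (induction rule: real_polynomial_function.induct)
  case (linear f)
  have "f = (\<lambda>x. \<Sum>i\<in>UNIV. f (axis i 1) * x $ i)"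
  proof
    fix x
    have "f x = f (\<Sum>i\<in>UNIV. x $ i *\<^sub>R axis i 1)"
      by (simp add: basis_expansion[of x, unfolded scalar_mult_eq_scaleR])
    also have "\<dots> = (\<Sum>i\<in>UNIV. f (axis i 1) * x $ i)"
      using bounded_linear.linear[OF linear] by (simp add: linear_sum linear_scale mult.commute)
    finally show "f x = \<dots>" .
  qed
  moreover have "(\<lambda>x. \<Sum>i\<in>UNIV. f (axis i 1) * x $ i) \<in> poly_le 1"
    by (intro poly_le_sum poly_le_closed coord_in_poly_le) simp
  ultimately show ?case by metis
next
  case (const c)
  then show ?case using const_in_poly_le[of 0] by blast
next
  case (add f g)
  then obtain j k where "f \<in> poly_le j" "g \<in> poly_le k" by blast
  then have "f \<in> poly_le (max j k)" "g \<in> poly_le (max j k)"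
    by (auto elim: poly_le_mono)
  then show ?case using poly_le_closed(2) by blast
next
  case (mult f g)
  then show ?case using poly_le_mult by blast
qed

subsection \<open>Slices\<close>

text \<open>Restriction of a function to the plane \<open>x $ i = t\<close>, extended constantly in direction \<open>i\<close>,
  is composition with this map. In this form the restriction stays a function on the whole space.\<close>

definition slice :: "3 \<Rightarrow> real \<Rightarrow> real^3 \<Rightarrow> real^3"
  where "slice i t x = (\<chi> j. if j = i then t else x $ j)"

lemma slice_nth [simp]: "slice i t x $ j = (if j = i then t else x $ j)"
  by (simp add: slice_def)

lemma slice_same: "x $ i = t \<Longrightarrow> slice i t x = x"
  by (auto simp: vec_eq_iff)

lemma indep_of_slice: "indep_of i (\<lambda>x. p (slice i t x))"
  unfolding indep_of_def by (auto intro!: arg_cong[where f = p] simp: vec_eq_iff)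

lemma indep_of_iff_slice: "indep_of i p \<longleftrightarrow> (\<forall>x. p (slice i 0 x) = p x)"
proof
  assume "\<forall>x. p (slice i 0 x) = p x"
  then show "indep_of i p" using indep_of_slice[of i p 0] by simp
qed (simp add: indep_of_def)

lemma indep_ofD: "indep_of i p \<Longrightarrow> p (slice i t x) = p x"
  by (simp add: indep_of_def)

lemma monomial_split: "monomial a x = x $ i ^ a i * (\<Prod>j\<in>UNIV - {i}. x $ j ^ a j)"
  by (simp add: monomial_def prod.remove[of UNIV i])

lemma monomial_upd: "monomial (a(i := n)) x = x $ i ^ n * (\<Prod>j\<in>UNIV - {i}. x $ j ^ a j)"
  by (simp add: monomial_split[of _ _ i])

lemma monomial_slice: "monomial a (slice i t x) = t ^ a i * monomial (a(i := 0)) x"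
  by (simp add: monomial_split[of _ "slice i t x" i] monomial_upd)

lemma sum_upd: "sum (a(i := n)) UNIV + a i = sum a (UNIV :: 3 set) + (n :: nat)"
proof -
  have "sum (a(i := n)) UNIV = n + sum a (UNIV - {i})" "sum a UNIV = a i + sum a (UNIV - {i})"
    by (simp_all add: sum.remove[of UNIV i])
  then show ?thesis by simp
qed

lemma poly_le_slice: "p \<in> poly_le k \<Longrightarrow> (\<lambda>x. p (slice i t x)) \<in> poly_le k"
proof (induction rule: poly_le_induct)
  case (step c a p)
  have "monomial (a(i := 0)) \<in> poly_le k"
    using step sum_upd[of a i 0] by (intro monomial_in_poly_le) linarith
  then show ?case
    using step by (auto simp: monomial_slice intro!: poly_le_closed)
qed (simp add: poly_le_closed)

lemma poly_hom_slice_0: "p \<in> poly_hom k \<Longrightarrow> (\<lambda>x. p (slice i 0 x)) \<in> poly_hom k"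
proof (induction rule: poly_hom_induct)
  case (step c a p)
  have "(\<lambda>x. monomial a (slice i 0 x)) \<in> poly_hom k"
  proof (cases "a i = 0")
    case True
    then have "a(i := 0) = a" by auto
    then show ?thesis
      using step True monomial_in_poly_hom[of a k] by (simp add: monomial_slice del: of_nat_sum)
  qed (simp add: monomial_slice poly_hom_closed zero_power)
  then show ?case
    using step by (auto intro!: poly_hom_closed)
qed (simp add: poly_hom_closed)

text \<open>The factor theorem in the variable \<open>x $ i\<close>, with a degree bound on the quotient: on monomials it is
  the factorization of \<open>x\<^sup>n - t\<^sup>n\<close>.\<close>

lemma poly_le_divide_slice:
  assumes "p \<in> poly_le k"
  shows "\<exists>g\<in>poly_le (k - 1). \<forall>x. p x = p (slice i t x) + (x $ i - t) * g x"
  using assms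
proof (induction rule: poly_le_induct)
  case zero
  show ?case by (rule bexI[of _ "\<lambda>x. 0"]) (simp_all add: poly_le_closed)
next
  case (step c a p)
  then obtain g where g: "g \<in> poly_le (k - 1)" "\<And>x. p x = p (slice i t x) + (x $ i - t) * g x"
    by blast
  define m where "m x = (\<Sum>l<a i. t ^ (a i - Suc l) * monomial (a(i := l)) x)" for x
  have "monomial (a(i := l)) \<in> poly_le (k - 1)" if "l < a i" for l
    using step sum_upd[of a i l] that by (intro monomial_in_poly_le) linarith
  then have cmg: "(\<lambda>x. c * m x + g x) \<in> poly_le (k - 1)"
    unfolding m_def using g by (intro poly_le_closed poly_le_sum) auto
  have m: "monomial a x = monomial a (slice i t x) + (x $ i - t) * m x" for x
  proof -
    let ?r = "\<Prod>j\<in>UNIV - {i}. x $ j ^ a j"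
    have "(x $ i - t) * m x = (x $ i ^ a i - t ^ a i) * ?r"
      by (simp add: m_def monomial_upd power_diff_sumr2 sum_distrib_right sum_distrib_left mult.assoc)
    then show ?thesis
      by (simp add: monomial_slice monomial_upd monomial_split[of a x i] algebra_simps)
  qed
  have "c * monomial a x + p x = c * monomial a (slice i t x) + p (slice i t x)
      + (x $ i - t) * (c * m x + g x)" for x
    unfolding m[of x] g(2)[of x] by (simp add: algebra_simps)
  then show ?case by (intro bexI[OF _ cmg] allI)
qed

subsection \<open>Homogeneity\<close>

lemma poly_hom_scale: "p \<in> poly_hom (int m) \<Longrightarrow> p (t *\<^sub>R x) = t ^ m * p x"
proof (induction rule: poly_hom_induct)
  case (step c a p)
  have "monomial a (t *\<^sub>R x) = t ^ m * monomial a x"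
    using step by (simp add: monomial_def power_mult_distrib prod.distrib power_sum[symmetric] del: of_nat_sum)
  then show ?case using step by (simp add: algebra_simps)
qed simp

text \<open>Restricting to lines gives univariate polynomials, whose degrees and roots are then available.\<close>

lemma poly_le_on_line:
  assumes "p \<in> poly_le k"
  shows "\<exists>P. (\<forall>t. p (y + t *\<^sub>R x) = poly P t) \<and> (P = 0 \<or> int (degree P) \<le> k)"
  using assms
proof (induction rule: poly_le_induct)
  case zero
  show ?case by (rule exI[of _ 0]) simp
next
  case (step c a p)
  then obtain P where P: "\<And>t. p (y + t *\<^sub>R x) = poly P t" "P = 0 \<or> int (degree P) \<le> k" by blast
  define M where "M = (\<Prod>i\<in>UNIV. [:y $ i, x $ i:] ^ a i)"
  have M: "monomial a (y + t *\<^sub>R x) = poly M t" for t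
    by (simp add: monomial_def M_def poly_prod algebra_simps)
  have "degree M \<le> (\<Sum>i\<in>UNIV. degree ([:y $ i, x $ i:] ^ a i))"
    unfolding M_def using degree_prod_sum_le[of UNIV "\<lambda>i. [:y $ i, x $ i:] ^ a i"] by (simp add: comp_def)
  also have "\<dots> \<le> sum a UNIV"
    by (intro sum_mono order.trans[OF degree_power_le]) auto
  finally have "int (degree M) \<le> k" using step by linarith
  then have "int (degree (smult c M + P)) \<le> k"
    using P(2) degree_add_le_max[of "smult c M" P] degree_smult_le[of c M] by (auto simp: max_def split: if_splits)
  then show ?case
    using P(1) M by (intro exI[of _ "smult c M + P"]) auto
qed

text \<open>On the line through the origin and \<open>x\<close> a form of degree \<open>k\<close> is \<open>p x * t\<^sup>k\<close>, while the second
  hypothesis bounds the degree in \<open>t\<close> by \<open>k - 1\<close>.\<close>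

lemma poly_hom_inter_poly_le:
  assumes p: "p \<in> poly_hom k" and q: "p \<in> poly_le (k - 1)"
  shows "p = 0"
proof
  fix x
  show "p x = 0 x"
  proof (cases "k < 0")
    case True
    then show ?thesis using poly_le_neg[of p "k - 1"] q by simp
  next
    case False
    define m where "m = nat k"
    obtain P where P: "\<And>t. p (0 + t *\<^sub>R x) = poly P t" "P = 0 \<or> int (degree P) \<le> k - 1"
      using poly_le_on_line[OF q, of 0 x] by blast
    have "poly P = poly (monom (p x) m)"
      using P(1) poly_hom_scale[of p m _ x] p False by (auto simp: fun_eq_iff poly_monom m_def mult.commute)
    then have "P = monom (p x) m" by (simp add: poly_eq_poly_eq_iff)
    then show ?thesis
      using P(2) False by (cases "p x = 0") (auto simp: degree_monom_eq m_def)
  qed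
qed

lemma poly_le_decompose:
  assumes "p \<in> poly_le k"
  shows "\<exists>q\<in>poly_le (k - 1). \<exists>r\<in>poly_hom k. \<forall>x. p x = q x + r x"
  using assms
proof (induction rule: poly_le_induct)
  case zero
  show ?case
    by (rule bexI[of _ "\<lambda>x. 0"], rule bexI[of _ "\<lambda>x. 0"]) (simp_all add: poly_le_closed poly_hom_closed)
next
  case (step c a p)
  then obtain q r where qr: "q \<in> poly_le (k - 1)" "r \<in> poly_hom k" "\<And>x. p x = q x + r x" by blast
  show ?case
  proof (cases "int (sum a UNIV) = k")
    case True
    then have "(\<lambda>x. c * monomial a x + r x) \<in> poly_hom k"
      using qr monomial_in_poly_hom by (intro poly_hom_closed) auto
    then show ?thesis using qr by (intro bexI[of _ q] bexI[of _ "\<lambda>x. c * monomial a x + r x"]) auto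
  next
    case False
    then have "(\<lambda>x. c * monomial a x + q x) \<in> poly_le (k - 1)"
      using qr step by (intro poly_le_closed monomial_in_poly_le) auto
    then show ?thesis using qr by (intro bexI[of _ "\<lambda>x. c * monomial a x + q x"] bexI[of _ r]) auto
  qed
qed

text \<open>Along the line from \<open>y\<close> to \<open>x\<close> the polynomial has infinitely many zeros near \<open>y\<close>.\<close>

lemma polynomial_zero_on_open:
  assumes p: "real_polynomial_function p" and U: "open U" "y \<in> U"
    and 0: "\<And>x. x \<in> U \<Longrightarrow> p x = 0"
  shows "p (x :: real^3) = 0"
proof -
  obtain k where "p \<in> poly_le k" using real_polynomial_function_imp_poly_le[OF p] ..
  then obtain P where P: "\<And>t. p (y + t *\<^sub>R (x - y)) = poly P t"
    using poly_le_on_line by blast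
  have "open ((\<lambda>t. y + t *\<^sub>R (x - y)) -` U)"
    by (intro open_vimage U continuous_intros)
  moreover have "0 \<in> (\<lambda>t. y + t *\<^sub>R (x - y)) -` U" using U by simp
  ultimately have "infinite ((\<lambda>t. y + t *\<^sub>R (x - y)) -` U)"
    using finite_imp_not_open by blast
  moreover have "(\<lambda>t. y + t *\<^sub>R (x - y)) -` U \<subseteq> {t. poly P t = 0}"
    by (auto simp: P[symmetric] 0)
  ultimately have "P = 0"
    using poly_roots_finite finite_subset by blast
  then show ?thesis using P[of 1] by simp
qed

subsection \<open>Partial derivatives\<close>

lemma has_derivative_pderiv3:
  assumes "real_polynomial_function g"
  shows "((\<lambda>t. g (x + t *\<^sub>R axis i 1)) has_real_derivative pderiv3 i g x) (at 0)"
proof -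
  have "real_polynomial_function (g \<circ> (\<lambda>t::real. x + t *\<^sub>R axis i 1))"
    by (intro real_polynomial_function_compose assms polynomial_function_add polynomial_function_const
        polynomial_function_bounded_linear bounded_linear_scaleR_left)
  then have "(g \<circ> (\<lambda>t::real. x + t *\<^sub>R axis i 1)) differentiable at 0"
    using differentiable_at_real_polynomial_function[of _ 0 UNIV] by blast
  then obtain D where "((\<lambda>t. g (x + t *\<^sub>R axis i 1)) has_real_derivative D) (at 0)"
    by (auto simp: comp_def elim: real_differentiableE)
  then show ?thesis
    by (simp add: pderiv3_def DERIV_imp_deriv)
qed

lemma pderiv3_eqI:
  "((\<lambda>t. g (x + t *\<^sub>R axis i 1)) has_real_derivative D) (at 0) \<Longrightarrow> pderiv3 i g x = D"
  by (simp add: pderiv3_def DERIV_imp_deriv)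

lemma pderiv3_cmult:
  assumes "real_polynomial_function f"
  shows "pderiv3 i (\<lambda>x. c * f x) x = c * pderiv3 i f x"
  by (rule pderiv3_eqI) (rule DERIV_cmult[OF has_derivative_pderiv3[OF assms]])

lemma pderiv3_rules:
  assumes "real_polynomial_function f" "real_polynomial_function g"
  shows "pderiv3 i (\<lambda>x. f x + g x) x = pderiv3 i f x + pderiv3 i g x"
    and "pderiv3 i (\<lambda>x. f x - g x) x = pderiv3 i f x - pderiv3 i g x"
    and "pderiv3 i (\<lambda>x. f x * g x) x = pderiv3 i f x * g x + f x * pderiv3 i g x"
proof -
  note d = has_derivative_pderiv3[OF assms(1), of x i] has_derivative_pderiv3[OF assms(2), of x i]
  show "pderiv3 i (\<lambda>x. f x + g x) x = pderiv3 i f x + pderiv3 i g x"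
    by (rule pderiv3_eqI[OF DERIV_add[OF d]])
  show "pderiv3 i (\<lambda>x. f x - g x) x = pderiv3 i f x - pderiv3 i g x"
    by (rule pderiv3_eqI[OF DERIV_diff[OF d]])
  show "pderiv3 i (\<lambda>x. f x * g x) x = pderiv3 i f x * g x + f x * pderiv3 i g x"
    using pderiv3_eqI[OF DERIV_mult[OF d]] by simp
qed

lemma pderiv3_const: "pderiv3 i (\<lambda>x. c) x = 0"
  by (rule pderiv3_eqI) simp

lemma pderiv3_coord: "pderiv3 i (\<lambda>x. x $ j) x = (if i = j then 1 else 0)"
  by (rule pderiv3_eqI) (auto intro!: derivative_eq_intros simp: axis_def)

lemma pderiv3_monomial: "pderiv3 i (monomial a) x = a i * monomial (a(i := a i - 1)) x"
proof (rule pderiv3_eqI)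
  have "monomial a (x + t *\<^sub>R axis i 1) = (x $ i + t) ^ a i * (\<Prod>j\<in>UNIV - {i}. x $ j ^ a j)" for t
    unfolding monomial_split[of a _ i] by (auto simp: axis_def intro!: prod.cong)
  then show "((\<lambda>t. monomial a (x + t *\<^sub>R axis i 1)) has_real_derivative
      a i * monomial (a(i := a i - 1)) x) (at 0)"
    by (auto simp: monomial_upd intro!: derivative_eq_intros)
qed

lemma poly_le_pderiv3: "p \<in> poly_le k \<Longrightarrow> pderiv3 i p \<in> poly_le k"
proof -
  assume p: "p \<in> poly_le k"
  then have "real_polynomial_function p \<and> (\<lambda>x. pderiv3 i p x) \<in> poly_le k"
  proof (induction rule: poly_le_induct)
    case (step c a p)
    have "monomial (a(i := a i - 1)) \<in> poly_le k"
      using step sum_upd[of a i "a i - 1"] by (intro monomial_in_poly_le) linarith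
    moreover have "real_polynomial_function (\<lambda>x. c * monomial a x)"
      by (intro real_polynomial_function.intros(2-) real_polynomial_function_monomial)
    ultimately show ?case
      using step real_polynomial_function_monomial[of a]
      by (auto simp: pderiv3_rules(1) pderiv3_cmult pderiv3_monomial
          intro!: poly_le_closed real_polynomial_function.intros(3))
  qed (auto simp: pderiv3_const poly_le_closed)
  then show ?thesis by simp
qed

lemma real_polynomial_function_pderiv3:
  "real_polynomial_function p \<Longrightarrow> real_polynomial_function (pderiv3 i p)"
  using real_polynomial_function_imp_poly_le poly_le_pderiv3 poly_le_imp_real_polynomial_function by blast

lemma pderiv3_indep_of: "indep_of i p \<Longrightarrow> pderiv3 i p x = 0"
proof -
  assume "indep_of i p"
  then have "p (x + t *\<^sub>R axis i 1) = p x" for t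
    unfolding indep_of_def by (auto simp: axis_def)
  then show ?thesis by (simp add: pderiv3_def)
qed

lemma euler_homogeneous:
  assumes "p \<in> poly_hom k"
  shows "(\<Sum>i\<in>UNIV. x $ i * pderiv3 i p x) = k * p x"
proof -
  have "real_polynomial_function p \<and> (\<Sum>i\<in>UNIV. x $ i * pderiv3 i p x) = k * p x"
    using assms
  proof (induction rule: poly_hom_induct)
    case (step c a p)
    have "x $ i * pderiv3 i (monomial a) x = a i * monomial a x" for i
      by (cases "a i") (auto simp: pderiv3_monomial monomial_upd monomial_split[of a _ i])
    then have "(\<Sum>i\<in>UNIV. x $ i * pderiv3 i (monomial a) x) = k * monomial a x"
      using step(1) by (simp add: sum_distrib_right[symmetric] of_nat_sum[symmetric] del: of_nat_sum)
    moreover have rpf: "real_polynomial_function (\<lambda>x. c * monomial a x)"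
      by (intro real_polynomial_function.intros(2-) real_polynomial_function_monomial)
    ultimately have "(\<Sum>i\<in>UNIV. x $ i * pderiv3 i (\<lambda>x. c * monomial a x + p x) x) =
        k * (c * monomial a x + p x)"
      using step real_polynomial_function_monomial[of a]
      by (simp add: pderiv3_rules(1) pderiv3_cmult sum.distrib ring_distribs mult.left_commute
          sum_distrib_left[symmetric] del: of_nat_sum)
    then show ?case
      using step rpf real_polynomial_function.intros(3) by blast
  qed (auto simp: pderiv3_const)
  then show ?thesis by simp
qed

section \<open>Integrals of polynomials over the box and its faces\<close>

text \<open>Fubini's theorem for integrands with separated variables, from the description of Lebesgue measure as
  a product measure. Monomials and \<open>B\<^sub>K\<close> both separate, so this is all of Fubini that the
  integration by parts uses.\<close>

lemma integral_cbox_prod: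
  fixes a b :: "real^'n" and f :: "'n \<Rightarrow> real \<Rightarrow> real"
  assumes f: "\<And>j. continuous_on {a $ j..b $ j} (f j)"
  shows "integral (cbox a b) (\<lambda>x. \<Prod>j\<in>UNIV. f j (x $ j)) = (\<Prod>j\<in>UNIV. integral {a $ j..b $ j} (f j))"
proof -
  define F where "F j t = indicator {a $ j..b $ j} t * f j t" for j t
  define G where "G v = F (axis_index v)" for v :: "real^'n"
  have F: "integrable lborel (F j)" for j
    using borel_integrable_compact[OF compact_Icc f[of j]] by (simp add: F_def[abs_def])
  have F_int: "integral\<^sup>L lborel (F j) = integral {a $ j..b $ j} (f j)" for j
    using set_borel_integral_eq_integral(2)[OF borel_integrable_atLeastAtMost'[OF f[of j]]]
    by (simp add: set_lebesgue_integral_def F_def[abs_def])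
  have FM [measurable]: "F j \<in> borel_measurable borel" for j
    using borel_measurable_integrable[OF F[of j]] by simp
  have Basis: "Basis = range (\<lambda>j. axis j 1 :: real^'n)"
    by (auto simp: Basis_vec_def)
  have inj: "inj (\<lambda>j. axis j 1 :: real^'n)"
    by (auto simp: inj_def axis_eq_axis)
  interpret product_sigma_finite "\<lambda>_::real^'n. lborel::real measure"
    by standard
  have "continuous_on (cbox a b) (\<lambda>x. \<Prod>j\<in>UNIV. f j (x $ j))"
  proof (intro continuous_on_prod continuous_on_compose2[OF f])
    show "(\<lambda>x. x $ j) ` cbox a b \<subseteq> {a $ j..b $ j}" for j
      by (auto simp: mem_box_cart)
  qed (auto intro: continuous_intros)
  then have "set_integrable lborel (cbox a b) (\<lambda>x. \<Prod>j\<in>UNIV. f j (x $ j))"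
    unfolding set_integrable_def by (intro borel_integrable_compact compact_cbox)
  then have "integral (cbox a b) (\<lambda>x. \<Prod>j\<in>UNIV. f j (x $ j))
      = (LINT x:cbox a b|lborel. (\<Prod>j\<in>UNIV. f j (x $ j)))"
    by (simp add: set_borel_integral_eq_integral)
  also have "\<dots> = (LINT x|lborel. (\<Prod>j\<in>UNIV. F j (x $ j)))"
    unfolding set_lebesgue_integral_def F_def prod.distrib
    by (intro Bochner_Integration.integral_cong refl)
      (auto simp: indicator_def mem_box_cart prod_eq_1_iff intro!: prod_zero split: if_splits)
  also have "\<dots> = integral\<^sup>L (Pi\<^sub>M Basis (\<lambda>_. lborel)) (\<lambda>g. \<Prod>j\<in>UNIV. F j ((\<Sum>v\<in>Basis. g v *\<^sub>R v) $ j))"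
    by (subst lborel_eq, subst integral_distr) auto
  also have "\<dots> = integral\<^sup>L (Pi\<^sub>M Basis (\<lambda>_. lborel)) (\<lambda>g. \<Prod>v\<in>Basis. G v (g v))"
  proof (intro Bochner_Integration.integral_cong refl)
    fix g :: "real^'n \<Rightarrow> real"
    have "(\<Sum>v\<in>Basis. g v *\<^sub>R v) $ j = g (axis j 1)" for j
      using inner_sum_left_Basis[of "axis j 1 :: real^'n" g] by (simp add: inner_axis)
    then show "(\<Prod>j\<in>UNIV. F j ((\<Sum>v\<in>Basis. g v *\<^sub>R v) $ j)) = (\<Prod>v\<in>Basis. G v (g v))"
      unfolding Basis by (simp add: prod.reindex inj G_def)
  qed
  also have "\<dots> = (\<Prod>v\<in>Basis. integral\<^sup>L lborel (G v))"
    using F by (intro product_integral_prod) (auto simp: G_def)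
  also have "\<dots> = (\<Prod>j\<in>UNIV. integral {a $ j..b $ j} (f j))"
    unfolding Basis by (simp add: prod.reindex inj G_def F_int)
  finally show ?thesis .
qed

lemma continuous_on_real_polynomial_function:
  "real_polynomial_function (p :: real^3 \<Rightarrow> real) \<Longrightarrow> continuous_on S p"
  using continuous_on_polymonial_function real_polynomial_function_eq by blast

lemma integrable_Kbox:
  fixes p :: "real^3 \<Rightarrow> real"
  shows "real_polynomial_function p \<Longrightarrow> p integrable_on Kbox c h"
  unfolding Kbox_def integrable_on_open_interval
  by (intro integrable_continuous continuous_on_real_polynomial_function)

lemmas rpf_rules =
  real_polynomial_function.intros(2-4) real_polynomial_function_diff real_polynomial_function_sum
  real_polynomial_function_prod real_polynomial_function_coord real_polynomial_function_minus
  real_polynomial_function_pderiv3 real_polynomial_function_monomial real_polynomial_function_power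

locale box_domain =
  fixes c h :: "real^3"
  assumes h_pos: "\<And>i. 0 < h $ i"
begin

lemma mem_Kbox: "x \<in> Kbox c h \<longleftrightarrow> (\<forall>i. c $ i - h $ i < x $ i \<and> x $ i < c $ i + h $ i)"
  by (simp add: Kbox_def mem_box_cart)

lemma Kbox_open: "open (Kbox c h)" and center_in_Kbox: "c \<in> Kbox c h"
  using h_pos by (simp_all add: mem_Kbox) (simp add: Kbox_def open_box)

lemma rpf_bubble_K [intro]: "real_polynomial_function (bubble_K c h)"
  unfolding bubble_K_def by (intro rpf_rules) auto

lemma rpf_face_factor [intro]: "real_polynomial_function (face_factor c h f)"
  unfolding face_factor_def by (intro rpf_rules)

lemma rpf_bubble_face [intro]: "real_polynomial_function (bubble_face c h f)"
  unfolding bubble_face_def by (intro rpf_rules) (auto simp: faces_def)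

text \<open>The divergence theorem for a field that vanishes on the boundary. For a monomial \<open>m\<close> the integrand is a product
  of functions of one variable each, whose factor in direction \<open>i\<close> is the derivative of a function that is zero
  at both end points.\<close>

lemma integral_pderiv3_bubble:
  assumes "real_polynomial_function m"
  shows "integral (Kbox c h) (pderiv3 i (\<lambda>x. bubble_K c h x * m x)) = 0"
proof -
  obtain k where "m \<in> poly_le k"
    using real_polynomial_function_imp_poly_le[OF assms] ..
  then have "real_polynomial_function m \<and> integral (Kbox c h) (pderiv3 i (\<lambda>x. bubble_K c h x * m x)) = 0"
  proof (induction rule: poly_le_induct)
    case zero
    then show ?case by (auto simp: pderiv3_const[abs_def] intro: rpf_rules)
  next
    case (step d a q)
    define f where "f j t = (t - c $ j + h $ j) * (c $ j + h $ j - t) * t ^ a j" for j and t :: real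
    define f' where "f' j t = (c $ j + h $ j - t) * t ^ a j - (t - c $ j + h $ j) * t ^ a j
        + (t - c $ j + h $ j) * (c $ j + h $ j - t) * (a j * t ^ (a j - 1))" for j and t :: real
    have f': "(f j has_real_derivative f' j t) (at t)" for j t
      unfolding f_def f'_def
      by (auto intro!: derivative_eq_intros simp: algebra_simps)
    have bub: "bubble_K c h x * monomial a x = (\<Prod>j\<in>UNIV. f j (x $ j))" for x
      by (simp add: bubble_K_def monomial_def f_def prod.distrib)
    have pd: "pderiv3 i (\<lambda>x. bubble_K c h x * monomial a x) x
        = (\<Prod>j\<in>UNIV. (if j = i then f' j else f j) (x $ j))" for x
    proof (rule pderiv3_eqI)
      let ?r = "\<Prod>j\<in>UNIV - {i}. f j (x $ j)"
      have 1: "bubble_K c h (x + t *\<^sub>R axis i 1) * monomial a (x + t *\<^sub>R axis i 1) = f i (x $ i + t) * ?r" for t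
        unfolding bub by (subst prod.remove[of UNIV i]) (auto simp: axis_def intro!: prod.cong)
      have 2: "(\<Prod>j\<in>UNIV. (if j = i then f' j else f j) (x $ j)) = f' i (x $ i) * ?r"
        by (subst prod.remove[of UNIV i]) (auto intro!: prod.cong)
      have "((\<lambda>t. f i (x $ i + t)) has_real_derivative f' i (x $ i)) (at 0)"
        using f'[of i "x $ i"] DERIV_at_within_shift[of "f i" "f' i (x $ i)" "x $ i" 0 UNIV]
        by (simp add: add.commute)
      then show "((\<lambda>t. bubble_K c h (x + t *\<^sub>R axis i 1) * monomial a (x + t *\<^sub>R axis i 1))
          has_real_derivative (\<Prod>j\<in>UNIV. (if j = i then f' j else f j) (x $ j))) (at 0)"
        unfolding 1 2 by (rule DERIV_cmult_right)
    qed
    have "integral (Kbox c h) (pderiv3 i (\<lambda>x. bubble_K c h x * monomial a x))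
       = integral (cbox (c - h) (c + h)) (\<lambda>x. \<Prod>j\<in>UNIV. (if j = i then f' j else f j) (x $ j))"
      unfolding Kbox_def integral_open_interval by (rule integral_cong) (rule pd)
    also have "\<dots> = (\<Prod>j\<in>UNIV. integral {(c - h) $ j..(c + h) $ j} (if j = i then f' j else f j))"
      by (rule integral_cbox_prod) (auto simp: f_def f'_def intro!: continuous_intros)
    also have "\<dots> = 0"
    proof -
      have "(f' i has_integral (f i (c $ i + h $ i) - f i (c $ i - h $ i))) {c $ i - h $ i..c $ i + h $ i}"
        using h_pos[of i] f'[of i]
        by (intro fundamental_theorem_of_calculus)
          (auto simp flip: has_real_derivative_iff_has_vector_derivative intro: has_field_derivative_at_within)
      then have "integral {(c - h) $ i..(c + h) $ i} (f' i) = 0"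
        by (auto dest!: integral_unique simp: f_def)
      then show ?thesis by (intro prod_zero) auto
    qed
    finally have 0: "integral (Kbox c h) (pderiv3 i (\<lambda>x. bubble_K c h x * monomial a x)) = 0" .
    have "(\<lambda>x. bubble_K c h x * (d * monomial a x + q x)) =
        (\<lambda>x. d * (bubble_K c h x * monomial a x) + bubble_K c h x * q x)"
      by (simp add: algebra_simps)
    then have eq: "pderiv3 i (\<lambda>x. bubble_K c h x * (d * monomial a x + q x)) =
      (\<lambda>x. d * pderiv3 i (\<lambda>x. bubble_K c h x * monomial a x) x + pderiv3 i (\<lambda>x. bubble_K c h x * q x) x)"
      using step by (simp add: fun_eq_iff pderiv3_rules(1) pderiv3_cmult rpf_rules rpf_bubble_K)
    have "integral (Kbox c h) (pderiv3 i (\<lambda>x. bubble_K c h x * (d * monomial a x + q x))) = 0"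
      unfolding eq using step 0
      by (subst integral_add)
        (auto intro!: integrable_Kbox rpf_rules)
    then show ?case using step by (auto intro!: rpf_rules)
  qed
  then show ?thesis by simp
qed

lemma zero_on_Kbox:
  assumes g: "real_polynomial_function g" and "\<And>x. x \<in> Kbox c h \<Longrightarrow> 0 \<le> g x"
    and 0: "integral (Kbox c h) g = 0" and x: "x \<in> Kbox c h"
  shows "g x = 0"
proof (rule has_integral_0_cbox_imp_0[of "c - h" "c + h"])
  show "(g has_integral 0) (cbox (c - h) (c + h))"
    using 0 integrable_Kbox[OF g, of c h]
    by (simp add: Kbox_def integral_open_interval has_integral_integrable_integral integrable_on_open_interval)
  show "x \<in> cbox (c - h) (c + h)" "box (c - h) (c + h) \<noteq> {}"
    using x box_subset_cbox by (auto simp: Kbox_def)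
qed (use assms in \<open>auto simp: Kbox_def intro: continuous_on_real_polynomial_function\<close>)

definition plane :: "face \<Rightarrow> real"
  where "plane f = c $ fst f + snd f * h $ fst f"

lemma slice_plane_in_face_set:
  assumes f: "f \<in> faces" and x: "x \<in> Kbox c h"
  shows "slice (fst f) (plane f) x \<in> face_set c h f"
proof -
  have "box (c - h) (c + h) \<noteq> {}"
    using x by (auto simp: Kbox_def)
  then have closure: "closure (Kbox c h) = cbox (c - h) (c + h)"
    by (simp add: Kbox_def closure_box)
  have "c $ j - h $ j \<le> x $ j" "x $ j \<le> c $ j + h $ j" for j
    using x by (simp_all add: mem_Kbox less_imp_le)
  moreover have "snd f = -1 \<or> snd f = 1"
    using f by (auto simp: faces_def)
  ultimately have "slice (fst f) (plane f) x \<in> closure (Kbox c h)"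
    using h_pos[of "fst f"] by (auto simp: closure mem_box_cart plane_def)
  then show ?thesis
    by (simp add: face_set_def plane_def)
qed

lemma face_setD: "f \<in> faces \<Longrightarrow> x \<in> face_set c h f \<Longrightarrow> x $ fst f = plane f"
  by (simp add: face_set_def plane_def)

lemma zero_on_face:
  assumes f: "f \<in> faces" and g: "real_polynomial_function g" and nonneg: "\<And>x. 0 \<le> g x"
    and 0: "face_integral c h f g = 0" and x: "x \<in> face_set c h f"
  shows "g x = 0"
proof -
  have cont: "continuous_on (face_rect c h f) (\<lambda>y. g (face_point c h f y))"
  proof (rule continuous_on_compose2[OF continuous_on_real_polynomial_function[OF g]])
    show "continuous_on (face_rect c h f) (face_point c h f)"
      unfolding face_point_def
      by (intro continuous_on_vec_lambda, rename_tac j, case_tac "j = fst f"; case_tac "j = fst f + 1")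
        (auto intro: continuous_intros)
  qed auto
  obtain y where y: "y \<in> face_rect c h f" "x = face_point c h f y"
    using x face_point_image[OF f] h_pos by blast
  define j k where "j = fst f + 1" and "k = fst f + 2"
  have rect: "face_rect c h f = cbox (c $ j - h $ j, c $ k - h $ k) (c $ j + h $ j, c $ k + h $ k)"
    by (simp add: face_rect_def j_def k_def Let_def)
  have "(\<lambda>y. g (face_point c h f y)) y = 0"
  proof (rule has_integral_0_cbox_imp_0[where f = "\<lambda>y. g (face_point c h f y)"])
    show "((\<lambda>y. g (face_point c h f y)) has_integral 0)
        (cbox (c $ j - h $ j, c $ k - h $ k) (c $ j + h $ j, c $ k + h $ k))"
      using 0 cont integrable_continuous[of "(c $ j - h $ j, c $ k - h $ k)"]
      by (simp add: face_integral_def rect has_integral_integrable_integral)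
    show "box (c $ j - h $ j, c $ k - h $ k) (c $ j + h $ j, c $ k + h $ k) \<noteq> {}"
      using h_pos[of j] h_pos[of k] by (auto simp: box_ne_empty Basis_prod_def inner_Pair)
  qed (use cont y nonneg in \<open>auto simp: rect\<close>)
  then show ?thesis using y by simp
qed

lemma rpf_slice: "real_polynomial_function g \<Longrightarrow> real_polynomial_function (\<lambda>x. g (slice i t x))"
  using real_polynomial_function_imp_poly_le poly_le_slice poly_le_imp_real_polynomial_function by blast

lemma polynomial_zero_on_Kbox:
  assumes "real_polynomial_function g" "\<And>x. x \<in> Kbox c h \<Longrightarrow> g x = 0"
  shows "g x = 0"
  using polynomial_zero_on_open[OF assms(1) Kbox_open center_in_Kbox assms(2)] .

end

section \<open>The curl of polynomial fields\<close>

text \<open>Vector fields with polynomial components, of any degree. It is the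
  hypothesis under which derivatives and integrals of a field behave linearly.\<close>

definition poly_field :: "(real^3 \<Rightarrow> real^3) \<Rightarrow> bool"
  where "poly_field u \<longleftrightarrow> (\<forall>i. real_polynomial_function (\<lambda>x. u x $ i))"

lemma poly_fieldD: "poly_field u \<Longrightarrow> real_polynomial_function (\<lambda>x. u x $ i)"
  by (simp add: poly_field_def)

lemma poly_vec_imp_poly_field: "p \<in> poly_vec k \<Longrightarrow> poly_field p"
  by (auto simp: poly_field_def poly_vec_def intro: poly_le_imp_real_polynomial_function)

lemma curl_nth:
  "curl u x $ 1 = pderiv3 2 (\<lambda>y. u y $ 3) x - pderiv3 3 (\<lambda>y. u y $ 2) x"
  "curl u x $ 2 = pderiv3 3 (\<lambda>y. u y $ 1) x - pderiv3 1 (\<lambda>y. u y $ 3) x"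
  "curl u x $ 3 = pderiv3 1 (\<lambda>y. u y $ 2) x - pderiv3 2 (\<lambda>y. u y $ 1) x"
  by (simp_all add: curl_def)

lemma inner_3: "(a :: real^3) \<bullet> b = (\<Sum>i\<in>UNIV. a $ i * b $ i)"
  by (simp add: inner_vec_def)

lemma poly_vec_curl: "p \<in> poly_vec k \<Longrightarrow> curl p \<in> poly_vec k"
  unfolding poly_vec_def mem_Collect_eq forall_3 curl_nth
  by (intro conjI poly_le_closed poly_le_pderiv3) auto

lemma poly_field_curl: "poly_field p \<Longrightarrow> poly_field (curl p)"
  unfolding poly_field_def forall_3 curl_nth by (auto intro!: rpf_rules)

lemma curl_add:
  assumes "poly_field u" "poly_field v"
  shows "curl (\<lambda>x. u x + v x) = (\<lambda>x. curl u x + curl v x)"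
  using poly_fieldD[OF assms(1)] poly_fieldD[OF assms(2)]
  by (simp add: fun_eq_iff vec_eq_iff forall_3 curl_nth pderiv3_rules)

lemma curl_scale:
  assumes "poly_field u"
  shows "curl (\<lambda>x. a *\<^sub>R u x) = (\<lambda>x. a *\<^sub>R curl u x)"
  using poly_fieldD[OF assms(1)]
  by (simp add: fun_eq_iff vec_eq_iff forall_3 curl_nth pderiv3_cmult algebra_simps)

section \<open>The serendipity space\<close>

definition hom_triples :: "int \<Rightarrow> (3 \<Rightarrow> real^3 \<Rightarrow> real) set"
  where "hom_triples m = prod_space UNIV (\<lambda>i. {p \<in> poly_hom m. indep_of i p})"

lemma hom_triples_iff: "w \<in> hom_triples m \<longleftrightarrow> (\<forall>i. w i \<in> poly_hom m \<and> indep_of i (w i))"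
  by (simp add: hom_triples_def prod_space_def)

text \<open>The product \<open>x $ i * serendipity_factor m w i x\<close> is component \<open>i\<close> of the curl in the definition of
  the serendipity space; see \<open>curl_serendipity\<close> below.\<close>

definition serendipity_factor :: "int \<Rightarrow> (3 \<Rightarrow> real^3 \<Rightarrow> real) \<Rightarrow> 3 \<Rightarrow> real^3 \<Rightarrow> real"
  where "serendipity_factor m w i x = (m + 3) * w i x - (\<Sum>j\<in>UNIV. w j x)"

definition serendipity_field :: "int \<Rightarrow> (3 \<Rightarrow> real^3 \<Rightarrow> real) \<Rightarrow> real^3 \<Rightarrow> real^3"
  where "serendipity_field m w x = (\<chi> i. x $ i * serendipity_factor m w i x)"

text \<open>Expanding the derivatives, \<open>w i\<close> contributes through the Euler operator only, since its derivative in direction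
  \<open>i\<close> is zero.\<close>

lemma curl_serendipity:
  assumes "w \<in> hom_triples m"
  shows "curl (\<lambda>x. vector [x$2 * x$3 * (w 2 x - w 3 x),
                           x$1 * x$3 * (w 3 x - w 1 x),
                           x$1 * x$2 * (w 1 x - w 2 x)]) = serendipity_field m w"
proof
  fix x :: "real^3"
  have rpf: "real_polynomial_function (w i)" for i
    using assms poly_le_imp_real_polynomial_function[OF poly_hom_le[of "w i" m]] by (simp add: hom_triples_iff)
  have own: "pderiv3 i (w i) x = 0" for i
    using assms by (auto simp: hom_triples_iff pderiv3_indep_of)
  have euler: "x$1 * pderiv3 1 (w i) x + x$2 * pderiv3 2 (w i) x + x$3 * pderiv3 3 (w i) x = m * w i x" for i
    using euler_homogeneous[of "w i" m x] assms by (simp add: hom_triples_iff sum_3)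
  show "curl (\<lambda>x. vector [x$2 * x$3 * (w 2 x - w 3 x),
                           x$1 * x$3 * (w 3 x - w 1 x),
                           x$1 * x$2 * (w 1 x - w 2 x)]) x = serendipity_field m w x"
    using euler[of 1] euler[of 2] euler[of 3]
    by (simp add: vec_eq_iff forall_3 curl_nth serendipity_field_def serendipity_factor_def sum_3 pderiv3_rules pderiv3_coord
        rpf rpf_rules own) algebra
qed

lemma S2_eq: "S2 m = {p + serendipity_field m w | p w. p \<in> poly_vec m \<and> w \<in> hom_triples m}"
  unfolding S2_def hom_triples_iff[symmetric]
  by (rule Collect_cong, rule ex_cong1, rule ex_cong1) (auto simp: curl_serendipity)

lemma serendipity_factor_in_poly_hom:
  assumes "w \<in> hom_triples m"
  shows "serendipity_factor m w i \<in> poly_hom m"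
proof -
  have w: "w j \<in> poly_hom m" for j
    using assms by (simp add: hom_triples_iff)
  have "(\<lambda>x. (m + 3) * w i x - (w 1 x + w 2 x + w 3 x)) \<in> poly_hom m"
    using w by (intro poly_hom_closed)
  then show ?thesis
    by (simp add: serendipity_factor_def[abs_def] sum_3)
qed

text \<open>The hypothesis expresses \<open>w i\<close> through the restrictions of the \<open>w j\<close> to the plane \<open>x $ i = 0\<close>. Evaluating it first at the
  origin, then on the coordinate axes and then on the coordinate planes, the values of the \<open>w i\<close> that
  are not yet known to be zero solve a homogeneous linear system whose matrix \<open>n I - J\<close> (\<open>J\<close> all ones, of size 3, 2 and 1) is invertible as \<open>n \<ge> 4\<close>. Independence
  of \<open>w i\<close> from \<open>x $ i\<close> transports the values from the plane \<open>x $ i = 0\<close> to the whole space.\<close>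

lemma hom_triples_zero:
  assumes w: "w \<in> hom_triples m" and m: "1 \<le> m"
    and 0: "\<And>i x. serendipity_factor m w i (slice i 0 x) = 0"
  shows "w = 0"
proof -
  define n where "n = real_of_int m + 3"
  have n: "4 \<le> n" using m by (simp add: n_def)
  have ind: "w i (slice i t x) = w i x" for i t x
    using w by (auto simp: hom_triples_iff intro: indep_ofD)
  have eq: "n * w i x = (\<Sum>j\<in>UNIV. w j (slice i 0 x))" for i x
    using 0[of i x] by (simp add: serendipity_factor_def ind n_def)
  have origin: "w i 0 = 0" for i
  proof -
    have s: "slice j 0 0 = (0 :: real^3)" for j by (simp add: vec_eq_iff)
    have "n * (\<Sum>j\<in>UNIV. w j 0) = 3 * (\<Sum>j\<in>UNIV. w j 0)"
      using eq[of _ 0] by (simp add: sum_distrib_left s)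
    then have "(\<Sum>j\<in>UNIV. w j 0) = 0" using n by auto
    then show ?thesis using eq[of i 0] n by (simp add: s)
  qed
  have axis: "w i x = 0" if x: "\<And>j. j \<noteq> k \<Longrightarrow> x $ j = 0" for i k x
  proof -
    have "slice k 0 x = 0" using x by (auto simp: vec_eq_iff)
    then have k: "w k x = 0" using ind[of k 0 x] origin by simp
    define S where "S = (\<Sum>j\<in>UNIV. w j x)"
    have nk: "n * w j x = S" if "j \<noteq> k" for j
      using eq[of j x] x[OF that] by (simp add: slice_same S_def)
    have "n * S = n * w k x + (\<Sum>j\<in>UNIV - {k}. n * w j x)"
      by (simp add: S_def sum_distrib_left sum.remove[of UNIV k] distrib_left)
    also have "\<dots> = 2 * S"
      using k nk by (simp add: card_Diff_singleton)
    finally have "S = 0" using n by auto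
    then show ?thesis using k nk[of i] n by (cases "i = k") auto
  qed
  have "w i x = 0" for i x
  proof -
    define y where "y = slice i 0 x"
    have "w j y = 0" if "j \<noteq> i" for j
    proof -
      obtain k where "\<And>l. l \<noteq> k \<Longrightarrow> slice j 0 y $ l = 0"
      proof (rule that)
        \<comment> \<open>The three elements of the index type add up to 0, so \<open>- i - j\<close> is the third index.\<close>
        fix l assume "l \<noteq> - i - j"
        then have "l = i \<or> l = j"
          using \<open>j \<noteq> i\<close> exhaust_3[of i] exhaust_3[of j] exhaust_3[of l] by auto
        then show "slice j 0 y $ l = 0" by (auto simp: y_def)
      qed
      then show ?thesis using axis[of _ "slice j 0 y" j] ind by metis
    qed
    then have "(\<Sum>j\<in>UNIV. w j y) = w i y"
      by (simp add: sum.remove[of UNIV i])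
    moreover have "slice i 0 y = y" by (simp add: y_def slice_same)
    ultimately have "n * w i y = w i y" using eq[of i y] by simp
    then show ?thesis using n ind[of i 0 x] by (auto simp: y_def)
  qed
  then show ?thesis by (simp add: fun_eq_iff)
qed

lemma slice_slice [simp]: "slice i s (slice i t x) = slice i s x"
  by (simp add: vec_eq_iff)

text \<open>Subtracting the equations for the two planes, the part of \<open>p\<close> without \<open>x $ i\<close> cancels. What remains has
  degree below \<open>m\<close>, apart from \<open>t1 - t2\<close> times the part of the form \<open>W\<close> without \<open>x $ i\<close>.\<close>

lemma zero_on_two_planes_imp_serendipity_factor_zero:
  assumes p: "p \<in> poly_le m" and W: "W \<in> poly_hom m" and t: "t1 \<noteq> t2"
    and 0: "\<And>x t. t \<in> {t1, t2} \<Longrightarrow> p (slice i t x) + t * W (slice i t x) = 0"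
  shows "W (slice i 0 x) = 0"
proof -
  obtain g where g: "g \<in> poly_le (m - 1)" "\<And>x. p x = p (slice i 0 x) + x $ i * g x"
    using poly_le_divide_slice[OF p, of i 0] by auto
  obtain k where k: "k \<in> poly_le (m - 1)" "\<And>x. W x = W (slice i 0 x) + x $ i * k x"
    using poly_le_divide_slice[OF poly_hom_le[OF W], of i 0] by auto
  define r where "r x = - 1 / (t1 - t2) * ((t1 * g (slice i t1 x) - t2 * g (slice i t2 x))
       + (t1 ^ 2 * k (slice i t1 x) - t2 ^ 2 * k (slice i t2 x)))" for x
  have r: "r \<in> poly_le (m - 1)"
    unfolding r_def by (intro poly_le_closed poly_le_slice g k)
  have "W (slice i 0 x) = r x" for x
  proof -
    have "p (slice i 0 x) + t * g (slice i t x) + t * (W (slice i 0 x) + t * k (slice i t x)) = 0"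
      if "t \<in> {t1, t2}" for t
      using 0[OF that, of x] g(2)[of "slice i t x"] k(2)[of "slice i t x"] by simp
    from this[of t1] this[of t2]
    have "(t1 - t2) * W (slice i 0 x) = - ((t1 * g (slice i t1 x) - t2 * g (slice i t2 x))
       + (t1 ^ 2 * k (slice i t1 x) - t2 ^ 2 * k (slice i t2 x)))"
      by (simp add: algebra_simps power2_eq_square)
    then show ?thesis using t by (simp add: r_def field_simps)
  qed
  then have "(\<lambda>x. W (slice i 0 x)) \<in> poly_le (m - 1)"
    using r by presburger
  with poly_hom_inter_poly_le[OF poly_hom_slice_0[OF W]]
  show ?thesis by (metis zero_fun_apply)
qed

context box_domain
begin

lemma face_integral_cong:
  assumes "f \<in> faces" "\<And>x. x \<in> face_set c h f \<Longrightarrow> g x = g' x"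
  shows "face_integral c h f g = face_integral c h f g'"
  unfolding face_integral_def
proof (rule integral_cong)
  fix y assume "y \<in> face_rect c h f"
  then have "face_point c h f y \<in> face_set c h f"
    using face_point_image[OF assms(1)] h_pos by blast
  then show "g (face_point c h f y) = g' (face_point c h f y)" by (rule assms(2))
qed

lemma zero_on_face_set:
  assumes f: "f \<in> faces" and g: "real_polynomial_function g"
    and 0: "\<And>x. x \<in> face_set c h f \<Longrightarrow> g x = 0"
  shows "g (slice (fst f) (plane f) x) = 0"
  by (rule polynomial_zero_on_Kbox[OF rpf_slice[OF g]]) (rule 0[OF slice_plane_in_face_set[OF f]])

lemma planes_distinct: "plane (i, 1) \<noteq> plane (i, -1)"
  using h_pos[of i] by (simp add: plane_def)

lemma inner_normal: "v \<bullet> normal f = snd f * v $ fst f"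
  by (simp add: normal_def inner_axis mult.commute)

text \<open>On the face the coordinate \<open>x\<^sub>i\<close> is the constant \<open>t\<close>, which lowers the degree of the normal
  component from \<open>m + 1\<close> to \<open>m\<close>: it is itself an admissible test function.\<close>

lemma normal_trace_zero:
  assumes p: "p \<in> poly_vec m" and w: "w \<in> hom_triples m" and f: "f \<in> faces"
    and u: "\<And>x. u x = p x + serendipity_field m w x"
    and dof: "\<And>q. q \<in> poly_face m f \<Longrightarrow> face_integral c h f (\<lambda>x. (u x \<bullet> normal f) * q x) = 0"
  shows "u (slice (fst f) (plane f) x) $ fst f = 0"
proof -
  define i t where "i = fst f" and "t = plane f"
  have pi: "(\<lambda>x. p x $ i) \<in> poly_le m"
    using p by (simp add: poly_vec_def)
  have W: "serendipity_factor m w i \<in> poly_le m"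
    using serendipity_factor_in_poly_hom[OF w] poly_hom_le by blast
  define q where "q x = u (slice i t x) $ i" for x
  have "q = (\<lambda>x. p (slice i t x) $ i + t * serendipity_factor m w i (slice i t x))"
    by (simp add: q_def u serendipity_field_def fun_eq_iff)
  also have "\<dots> \<in> poly_le m"
    using pi W by (intro poly_le_closed poly_le_slice[where p = "\<lambda>x. p x $ i"] poly_le_slice)
  finally have q_le: "q \<in> poly_le m" .
  have q_ind: "indep_of i q"
    using indep_of_slice[of i "\<lambda>x. u x $ i" t] by (simp add: q_def[abs_def])
  have s: "snd f * snd f = 1" using f by (auto simp: faces_def)
  have rq: "real_polynomial_function q"
    using poly_le_imp_real_polynomial_function[OF q_le] .
  have "(\<lambda>x. snd f * q x) \<in> poly_face m f"
    using q_le q_ind by (auto simp: poly_face_def i_def indep_of_def intro: poly_le_closed)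
  then have "0 = face_integral c h f (\<lambda>x. (u x \<bullet> normal f) * (snd f * q x))"
    using dof by simp
  also have "\<dots> = face_integral c h f (\<lambda>x. q x * q x)"
  proof (rule face_integral_cong[OF f])
    fix x assume "x \<in> face_set c h f"
    then have "slice i t x = x"
      using face_setD[OF f] by (simp add: slice_same i_def t_def)
    then have "u x \<bullet> normal f = snd f * q x"
      by (simp add: inner_normal q_def i_def)
    then have "(u x \<bullet> normal f) * (snd f * q x) = (snd f * snd f) * (q x * q x)"
      by (simp only: mult_ac)
    then show "(u x \<bullet> normal f) * (snd f * q x) = q x * q x"
      by (simp add: s)
  qed
  finally have "q x * q x = 0" if "x \<in> face_set c h f" for x
    using that rq by (intro zero_on_face[OF f, of "\<lambda>x. q x * q x"]) (auto intro: rpf_rules)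
  then have "q (slice (fst f) (plane f) x) = 0" for x
    using zero_on_face_set[OF f rq] by simp
  then show ?thesis by (simp add: q_def i_def t_def)
qed

lemma poly_le_two_planes:
  assumes p: "p \<in> poly_le m"
    and 0: "\<And>s x. s \<in> {-1, 1} \<Longrightarrow> p (slice i (plane (i, s)) x) = 0"
  obtains k where "k \<in> poly_le (m - 2)" "\<And>x. p x = (x $ i - plane (i, 1)) * (x $ i - plane (i, -1)) * k x"
proof -
  obtain g where g: "g \<in> poly_le (m - 1)" "\<And>x. p x = (x $ i - plane (i, 1)) * g x"
    using poly_le_divide_slice[OF p, of i "plane (i, 1)"] 0[of 1] by auto
  have "g (slice i (plane (i, -1)) x) = 0" for x
    using 0[of "-1" x] g(2)[of "slice i (plane (i, -1)) x"] planes_distinct[of i] by simp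
  then obtain k where "k \<in> poly_le (m - 1 - 1)" "\<And>x. g x = (x $ i - plane (i, -1)) * k x"
    using poly_le_divide_slice[OF g(1), of i "plane (i, -1)"] by auto
  then show ?thesis using that g(2) by (simp add: mult.assoc)
qed

lemma face_dofs_zero_imp_hom_zero:
  assumes p: "p \<in> poly_vec m" and w: "w \<in> hom_triples m" and m: "1 \<le> m"
    and u: "\<And>x. u x = p x + serendipity_field m w x"
    and dof: "\<And>f q. f \<in> faces \<Longrightarrow> q \<in> poly_face m f \<Longrightarrow> face_integral c h f (\<lambda>x. (u x \<bullet> normal f) * q x) = 0"
  shows "w = 0"
proof (rule hom_triples_zero[OF w m])
  fix i x
  have f: "(i, s) \<in> faces" if "s \<in> {-1, 1}" for s
    using that by (auto simp: faces_def)
  have tr: "u (slice i (plane (i, s)) x) $ i = 0" if "s \<in> {-1, 1}" for s x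
    using normal_trace_zero[OF p w f[OF that] u dof[OF f[OF that]]] by simp
  show "serendipity_factor m w i (slice i 0 x) = 0"
  proof (rule zero_on_two_planes_imp_serendipity_factor_zero[OF _ _ planes_distinct])
    show "(\<lambda>x. p x $ i) \<in> poly_le m" using p by (simp add: poly_vec_def)
    show "serendipity_factor m w i \<in> poly_hom m" using serendipity_factor_in_poly_hom[OF w] .
    show "p (slice i t x) $ i + t * serendipity_factor m w i (slice i t x) = 0" if "t \<in> {plane (i, 1), plane (i, -1)}" for x t
      using that tr[of 1 x] tr[of "-1" x] by (auto simp: u serendipity_field_def)
  qed
qed

lemma poly_field_inner: "poly_field u \<Longrightarrow> poly_field v \<Longrightarrow> real_polynomial_function (\<lambda>x. u x \<bullet> v x)"
  unfolding inner_3 by (auto simp: poly_field_def intro!: rpf_rules)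

text \<open>Once \<open>w = 0\<close>, component \<open>i\<close> of the polynomial field has the factors of the two faces orthogonal to
  direction \<open>i\<close>. Their product is negative inside the box, so testing with the quotients yields an integral of a
  function of constant sign.\<close>

lemma serendipity_unisolvent:
  assumes p: "p \<in> poly_vec m" and w: "w \<in> hom_triples m" and m: "1 \<le> m"
    and u: "\<And>x. u x = p x + serendipity_field m w x"
    and dof: "\<And>f q. f \<in> faces \<Longrightarrow> q \<in> poly_face m f \<Longrightarrow> face_integral c h f (\<lambda>x. (u x \<bullet> normal f) * q x) = 0"
    and int: "\<And>q. q \<in> poly_vec (m - 2) \<Longrightarrow> integral (Kbox c h) (\<lambda>x. u x \<bullet> q x) = 0"
  shows "u x = 0"
proof -
  have w0: "w = 0" by (rule face_dofs_zero_imp_hom_zero[OF p w m u dof])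
  then have up: "u = p" by (auto simp: u fun_eq_iff serendipity_field_def serendipity_factor_def vec_eq_iff)
  define b where "b i x = (x $ i - plane (i, 1)) * (x $ i - plane (i, -1))" for i and x :: "real^3"
  have "\<exists>k. k \<in> poly_le (m - 2) \<and> (\<forall>x. u x $ i = b i x * k x)" for i
  proof -
    have f: "(i, s) \<in> faces" if "s \<in> {-1, 1}" for s
      using that by (auto simp: faces_def)
    have tr: "u (slice i (plane (i, s)) x) $ i = 0" if "s \<in> {-1, 1}" for s x
      using normal_trace_zero[OF p w f[OF that] u dof[OF f[OF that]]] by simp
    have "(\<lambda>x. u x $ i) \<in> poly_le m" using p up by (simp add: poly_vec_def)
    from poly_le_two_planes[OF this tr] show ?thesis unfolding b_def by metis
  qed
  then obtain k where k: "\<And>i. k i \<in> poly_le (m - 2)" "\<And>i x. u x $ i = b i x * k i x"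
    by metis
  have rk: "real_polynomial_function (k i)" for i
    using poly_le_imp_real_polynomial_function[OF k(1)] .
  define q where "q x = (\<chi> i. - k i x)" for x
  have "q \<in> poly_vec (m - 2)"
    using k(1) by (auto simp: poly_vec_def q_def intro: poly_le_closed)
  then have I: "integral (Kbox c h) (\<lambda>x. u x \<bullet> q x) = 0" by (rule int)
  have uq: "u x \<bullet> q x = (\<Sum>i\<in>UNIV. - b i x * (k i x)\<^sup>2)" for x
    by (simp add: inner_3 k(2) q_def power2_eq_square mult.assoc)
  have b: "b i x < 0" if "x \<in> Kbox c h" for i x
    using that by (auto simp: b_def mem_Kbox plane_def mult_less_0_iff)
  have nonneg: "0 \<le> - b i x * (k i x)\<^sup>2" if "x \<in> Kbox c h" for i x
    using b[OF that, of i] by (intro mult_nonneg_nonneg) auto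
  have "real_polynomial_function (\<lambda>x. u x \<bullet> q x)"
    unfolding uq b_def by (intro rpf_rules rk) auto
  then have "u x \<bullet> q x = 0" if "x \<in> Kbox c h" for x
    using zero_on_Kbox[OF _ _ I that] nonneg by (simp add: uq sum_nonneg)
  then have sum0: "(\<Sum>i\<in>UNIV. - b i x * (k i x)\<^sup>2) = 0" if "x \<in> Kbox c h" for x
    using that uq by metis
  have "k i x = 0" if "x \<in> Kbox c h" for i x
  proof -
    have "- b i x * (k i x)\<^sup>2 = 0"
      using sum_nonneg_0[OF _ _ sum0[OF that]] nonneg[OF that] by simp
    then show ?thesis using b[OF that, of i] by simp
  qed
  then have "k i x = 0" for i x
    using polynomial_zero_on_Kbox[OF rk] by blast
  then show ?thesis by (simp add: vec_eq_iff k(2))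
qed

end

section \<open>The bubble fields\<close>

lemma normal_nth: "normal f $ j = (if j = fst f then snd f else 0)"
  by (simp add: normal_def axis_def)

lemma poly_field_cross3: "poly_field u \<Longrightarrow> poly_field v \<Longrightarrow> poly_field (\<lambda>x. cross3 (u x) (v x))"
  unfolding poly_field_def forall_3 cross_components by (auto intro!: rpf_rules)

lemma poly_field_scaleR: "real_polynomial_function b \<Longrightarrow> poly_field u \<Longrightarrow> poly_field (\<lambda>x. b x *\<^sub>R u x)"
  by (auto simp: poly_field_def intro!: rpf_rules)

lemma poly_field_sum: "(\<And>i. i \<in> I \<Longrightarrow> poly_field (u i)) \<Longrightarrow> poly_field (\<lambda>x. \<Sum>i\<in>I. u i x)"
  unfolding poly_field_def sum_component by (cases "finite I") (auto intro!: rpf_rules)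

lemma poly_le_cmult_right: "p \<in> poly_le k \<Longrightarrow> (\<lambda>x. p x * a) \<in> poly_le k"
  using poly_le_closed(4)[of p k a] by (simp add: mult.commute)

lemma poly_vec_cross3: "p \<in> poly_vec k \<Longrightarrow> (\<lambda>x. cross3 (p x) a) \<in> poly_vec k"
  unfolding poly_vec_def mem_Collect_eq forall_3 cross_components
  by (intro conjI poly_le_closed(3,4) poly_le_cmult_right) simp_all

lemma poly_vec_cross3_left: "p \<in> poly_vec k \<Longrightarrow> (\<lambda>x. cross3 a (p x)) \<in> poly_vec k"
  using poly_vec_cross3[of "\<lambda>x. - p x" k a]
  by (simp add: cross_skew[of a] poly_vec_def poly_le_closed)

lemma faces_snd: "f \<in> faces \<Longrightarrow> snd f * snd f = 1"
  by (auto simp: faces_def)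

lemma normal_unit: "f \<in> faces \<Longrightarrow> normal f \<bullet> normal f = 1"
  by (simp add: normal_def inner_axis_axis faces_snd)

text \<open>For a unit vector \<open>n\<close> this is the projection onto the plane orthogonal to \<open>n\<close>.\<close>

lemma cross3_triple: "cross3 (cross3 n v) n = (n \<bullet> n) *\<^sub>R v - (n \<bullet> v) *\<^sub>R n"
  by (simp add: vec_eq_iff forall_3 cross_components inner_3 sum_3 algebra_simps)

text \<open>A cross product with the normal is tangential, and a tangential field is the
  cross product of its own rotation by a right angle with the normal.\<close>

lemma poly_vec_cross_iff:
  assumes "f \<in> faces"
  shows "q \<in> poly_vec_cross k (normal f) \<longleftrightarrow> q \<in> poly_vec k \<and> (\<forall>x. q x \<bullet> normal f = 0)"
proof
  assume "q \<in> poly_vec_cross k (normal f)"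
  then show "q \<in> poly_vec k \<and> (\<forall>x. q x \<bullet> normal f = 0)"
    by (auto simp: poly_vec_cross_def dot_cross_self intro: poly_vec_cross3)
next
  assume q: "q \<in> poly_vec k \<and> (\<forall>x. q x \<bullet> normal f = 0)"
  then have "q = (\<lambda>x. cross3 (cross3 (normal f) (q x)) (normal f))"
    using normal_unit[OF assms] by (simp add: cross3_triple inner_commute)
  then show "q \<in> poly_vec_cross k (normal f)"
    unfolding poly_vec_cross_def mem_Collect_eq
    using q poly_vec_cross3_left[of q k "normal f"] by (intro exI[of _ "\<lambda>x. cross3 (normal f) (q x)"] conjI) auto
qed

lemma tangential_part_in_poly_vec_cross:
  "g \<in> poly_vec k \<Longrightarrow> (\<lambda>x. cross3 (cross3 (normal f) (g x)) (normal f)) \<in> poly_vec_cross k (normal f)"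
  unfolding poly_vec_cross_def mem_Collect_eq
  by (intro exI[of _ "\<lambda>x. cross3 (normal f) (g x)"] conjI refl poly_vec_cross3_left)

lemma vector_eq_minus_cross3:
  assumes "\<And>j k. P j k = - (n $ j * z $ k)"
  shows "vector [P 2 3 - P 3 2, P 3 1 - P 1 3, P 1 2 - P 2 1] = - cross3 n z"
  by (simp add: vec_eq_iff forall_3 assms cross_components mult.commute)

context box_domain
begin

lemma face_factor_eq: "f \<in> faces \<Longrightarrow> face_factor c h f x = - snd f * (x $ fst f - plane f)"
  using faces_snd[of f] by (simp add: face_factor_def plane_def algebra_simps mult.assoc[symmetric])

lemma finite_faces: "finite faces"
  by (simp add: faces_def)

text \<open>On the face \<open>f\<close> the factor of \<open>B\<^sub>K\<close> belonging to \<open>f\<close> is zero, so only the term in which this factor is differentiated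
  survives.\<close>

lemma pderiv3_bubble_mult:
  assumes f: "f \<in> faces" and x: "x $ fst f = plane f" and g: "real_polynomial_function g"
  shows "pderiv3 j (\<lambda>y. bubble_K c h y * g y) x = - normal f $ j * (bubble_face c h f x * g x)"
proof -
  have ff: "face_factor c h f x = 0"
    using f x by (simp add: face_factor_eq)
  have "pderiv3 j (face_factor c h f) x = pderiv3 j (\<lambda>x. (- snd f) * x $ fst f + snd f * plane f) x"
    by (rule arg_cong[where f = "\<lambda>g. pderiv3 j g x"]) (simp add: fun_eq_iff face_factor_eq[OF f] algebra_simps)
  also have "\<dots> = - normal f $ j"
    by (subst pderiv3_rules(1), (intro rpf_rules)+, subst pderiv3_cmult)
      (auto simp: rpf_rules pderiv3_coord pderiv3_const normal_nth)
  finally have d: "pderiv3 j (face_factor c h f) x = - normal f $ j" .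
  have "(\<lambda>y. bubble_K c h y * g y) = (\<lambda>y. face_factor c h f y * (bubble_face c h f y * g y))"
    using bubble_K_eq_face_factor_mult_bubble_face[OF f, of c h] by (simp add: mult.assoc)
  then show ?thesis
    by (simp add: pderiv3_rules(3)[OF rpf_face_factor real_polynomial_function.intros(4)[OF rpf_bubble_face g]] ff d)
qed

lemma curl_bubble_on_face:
  assumes f: "f \<in> faces" and x: "x $ fst f = plane f" and z: "poly_field z"
  shows "curl (\<lambda>y. bubble_K c h y *\<^sub>R z y) x = - cross3 (normal f) (bubble_face c h f x *\<^sub>R z x)"
proof -
  have d: "pderiv3 j (\<lambda>y. (bubble_K c h y *\<^sub>R z y) $ k) x = - (normal f $ j * (bubble_face c h f x *\<^sub>R z x) $ k)" for j k
    using pderiv3_bubble_mult[OF f x poly_fieldD[OF z], of j k] by simp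
  show ?thesis
    unfolding curl_def by (rule vector_eq_minus_cross3[OF d])
qed

lemma bubble_face_other:
  assumes "f \<in> faces" "g \<noteq> f" "x $ fst f = plane f"
  shows "bubble_face c h g x = 0"
  unfolding bubble_face_def
proof (rule prod_zero)
  show "\<exists>f'\<in>faces - {g}. face_factor c h f' x = 0"
    using assms by (intro bexI[of _ f]) (simp_all add: face_factor_eq)
qed (simp add: finite_faces)

lemma bubble_face_pos:
  assumes f: "f \<in> faces" and x: "x \<in> Kbox c h"
  shows "0 < bubble_face c h f (slice (fst f) (plane f) x)"
  unfolding bubble_face_def
proof (rule prod_pos)
  fix g assume g: "g \<in> faces - {f}"
  then have sg: "snd g = 1 \<or> snd g = -1" and sf: "snd f = 1 \<or> snd f = -1"
    using f by (auto simp: faces_def)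
  show "0 < face_factor c h g (slice (fst f) (plane f) x)"
  proof (cases "fst g = fst f")
    case True
    then have "snd g = - snd f" using g sg sf prod_eqI[of g f] by auto
    then show ?thesis
      using True h_pos[of "fst f"] faces_snd[OF f] by (simp add: face_factor_def plane_def mult.assoc[symmetric])
  next
    case False
    have "c $ fst g - h $ fst g < x $ fst g" "x $ fst g < c $ fst g + h $ fst g"
      using x by (simp_all add: mem_Kbox)
    then show ?thesis
      using False sg by (auto simp: face_factor_def)
  qed
qed

lemma bubble_K_pos:
  assumes "x \<in> Kbox c h"
  shows "0 < bubble_K c h x"
  unfolding bubble_K_def
proof (intro prod_pos mult_pos_pos)
  fix i
  have "c $ i - h $ i < x $ i" "x $ i < c $ i + h $ i"
    using assms by (simp_all add: mem_Kbox)
  then show "0 < x $ i - c $ i + h $ i" "0 < c $ i + h $ i - x $ i" by simp_all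
qed

text \<open>A family \<open>q\<close> of coefficients, one field for each face, encodes the bubble field
  \<open>B\<^sub>K \<Sum>\<^sub>f B\<^sub>f q\<^sub>f\<close>.\<close>

definition face_bubble_sum :: "(face \<Rightarrow> real^3 \<Rightarrow> real^3) \<Rightarrow> real^3 \<Rightarrow> real^3"
  where "face_bubble_sum q x = (\<Sum>f\<in>faces. bubble_face c h f x *\<^sub>R q f x)"

definition curl_bubble :: "(face \<Rightarrow> real^3 \<Rightarrow> real^3) \<Rightarrow> real^3 \<Rightarrow> real^3"
  where "curl_bubble q = curl (\<lambda>x. bubble_K c h x *\<^sub>R face_bubble_sum q x)"

definition bubble_coeffs :: "int \<Rightarrow> (face \<Rightarrow> real^3 \<Rightarrow> real^3) set"
  where "bubble_coeffs k = prod_space faces (V_face c h k)"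

lemma V_face_cross: "q \<in> V_face c h k f \<Longrightarrow> q \<in> poly_vec_cross k (normal f)"
  by (simp add: V_face_def)

lemma V_face_poly_vec: "f \<in> faces \<Longrightarrow> q \<in> V_face c h k f \<Longrightarrow> q \<in> poly_vec k"
  using V_face_cross[of q k f] poly_vec_cross_iff[of f q k] by simp

lemma V_face_tangential: "f \<in> faces \<Longrightarrow> q \<in> V_face c h k f \<Longrightarrow> q x \<bullet> normal f = 0"
  using V_face_cross[of q k f] poly_vec_cross_iff[of f q k] by simp

lemma bubble_coeffsD: "q \<in> bubble_coeffs k \<Longrightarrow> f \<in> faces \<Longrightarrow> q f \<in> V_face c h k f"
  by (simp add: bubble_coeffs_def prod_space_def)

lemma poly_field_bubble_coeffs: "q \<in> bubble_coeffs k \<Longrightarrow> f \<in> faces \<Longrightarrow> poly_field (q f)"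
  by (rule poly_vec_imp_poly_field[OF V_face_poly_vec[OF _ bubble_coeffsD]])

lemma rpf_face_bubble_sum: "q \<in> bubble_coeffs k \<Longrightarrow> poly_field (face_bubble_sum q)"
  unfolding face_bubble_sum_def[abs_def]
  by (intro poly_field_sum poly_field_scaleR rpf_bubble_face) (rule poly_field_bubble_coeffs)

lemma U_space_eq: "U_space c h k = curl_bubble ` bubble_coeffs k"
proof (intro equalityI subsetI)
  fix u assume "u \<in> U_space c h k"
  then obtain q where q: "\<forall>f\<in>faces. q f \<in> V_face c h k f"
    and u: "u = curl (\<lambda>x. bubble_K c h x *\<^sub>R (\<Sum>f\<in>faces. bubble_face c h f x *\<^sub>R q f x))"
    by (auto simp: U_space_def V_space_def)
  define q' where "q' f = (if f \<in> faces then q f else 0)" for f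
  have "q' \<in> bubble_coeffs k"
    using q by (simp add: bubble_coeffs_def prod_space_def q'_def)
  moreover have "u = curl_bubble q'"
    by (simp add: u curl_bubble_def face_bubble_sum_def q'_def)
  ultimately show "u \<in> curl_bubble ` bubble_coeffs k" by blast
next
  fix u assume "u \<in> curl_bubble ` bubble_coeffs k"
  then show "u \<in> U_space c h k"
    unfolding U_space_def V_space_def curl_bubble_def[abs_def] face_bubble_sum_def
    using bubble_coeffsD by blast
qed

lemma curl_bubble_on_face_eq:
  assumes f: "f \<in> faces" and q: "q \<in> bubble_coeffs k" and x: "x $ fst f = plane f"
  shows "curl_bubble q x = - (bubble_face c h f x)\<^sup>2 *\<^sub>R cross3 (normal f) (q f x)"
proof -
  have "face_bubble_sum q x = bubble_face c h f x *\<^sub>R q f x + (\<Sum>g\<in>faces - {f}. bubble_face c h g x *\<^sub>R q g x)"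
    using f finite_faces by (simp add: face_bubble_sum_def sum.remove)
  also have "(\<Sum>g\<in>faces - {f}. bubble_face c h g x *\<^sub>R q g x) = 0"
    using bubble_face_other[OF f _ x] by (intro sum.neutral) auto
  finally show ?thesis
    using curl_bubble_on_face[OF f x rpf_face_bubble_sum[OF q]]
    by (simp add: curl_bubble_def cross_mult_right power2_eq_square)
qed

lemma curl_bubble_normal_trace:
  assumes "f \<in> faces" "q \<in> bubble_coeffs k" "x $ fst f = plane f"
  shows "curl_bubble q x \<bullet> normal f = 0"
  by (simp add: curl_bubble_on_face_eq[OF assms] dot_cross_self)

lemma curl_bubble_tangential_trace:
  assumes f: "f \<in> faces" and q: "q \<in> bubble_coeffs k" and x: "x $ fst f = plane f"
  shows "cross3 (curl_bubble q x) (normal f) = - (bubble_face c h f x)\<^sup>2 *\<^sub>R q f x"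
proof -
  have "cross3 (cross3 (normal f) (q f x)) (normal f) = q f x"
    using normal_unit[OF f] V_face_tangential[OF f bubble_coeffsD[OF q f]]
    by (simp add: cross3_triple inner_commute)
  then show ?thesis
    by (simp add: curl_bubble_on_face_eq[OF assms] cross_mult_left)
qed

text \<open>The difference of the two integrands is the divergence of the cross product of \<open>B\<^sub>K z\<close> and \<open>g\<close>, which vanishes on the boundary.\<close>

lemma integral_curl_bubble_by_parts:
  assumes z: "poly_field z" and g: "poly_field g"
  shows "integral (Kbox c h) (\<lambda>x. curl (\<lambda>y. bubble_K c h y *\<^sub>R z y) x \<bullet> g x)
       = integral (Kbox c h) (\<lambda>x. bubble_K c h x * (z x \<bullet> curl g x))"
proof -
  define F where "F j = pderiv3 j (\<lambda>x. bubble_K c h x * cross3 (z x) (g x) $ j)" for j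
  have rF: "real_polynomial_function (F j)" for j
    unfolding F_def using poly_fieldD[OF poly_field_cross3[OF z g]] by (intro rpf_rules rpf_bubble_K)
  have IF: "integral (Kbox c h) (F j) = 0" for j
    unfolding F_def by (rule integral_pderiv3_bubble[OF poly_fieldD[OF poly_field_cross3[OF z g]]])
  note rz = poly_fieldD[OF z] and rg = poly_fieldD[OF g]
  have "curl (\<lambda>y. bubble_K c h y *\<^sub>R z y) x \<bullet> g x
      = bubble_K c h x * (z x \<bullet> curl g x) + (F 1 x + (F 2 x + F 3 x))" for x
    by (simp add: F_def inner_3 sum_3 curl_nth cross_components pderiv3_rules rz rg rpf_rules rpf_bubble_K)
      algebra
  then have "integral (Kbox c h) (\<lambda>x. curl (\<lambda>y. bubble_K c h y *\<^sub>R z y) x \<bullet> g x)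
    = integral (Kbox c h) (\<lambda>x. bubble_K c h x * (z x \<bullet> curl g x) + (F 1 x + (F 2 x + F 3 x)))"
    by simp
  also have "\<dots> = integral (Kbox c h) (\<lambda>x. bubble_K c h x * (z x \<bullet> curl g x))"
    using rF poly_field_inner[OF z poly_field_curl[OF g]]
    by (simp add: Henstock_Kurzweil_Integration.integral_add integrable_Kbox rpf_rules rpf_bubble_K IF)
  finally show ?thesis .
qed

text \<open>Orthogonality against tangential fields extends to all fields: members of \<open>V\<^sub>f\<close> are tangential and see
  only the tangential part.\<close>

lemma V_face_orthogonal:
  assumes f: "f \<in> faces" and q: "q \<in> V_face c h k f" and g: "g \<in> poly_vec (k - 1)"
  shows "integral (Kbox c h) (\<lambda>x. bubble_K c h x * bubble_face c h f x * (q x \<bullet> g x)) = 0"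
proof -
  let ?w = "\<lambda>x. cross3 (cross3 (normal f) (g x)) (normal f)"
  have "L2_inner c h q (\<lambda>x. (bubble_K c h x * bubble_face c h f x) *\<^sub>R ?w x) = 0"
    using q tangential_part_in_poly_vec_cross[OF g, of f] by (simp add: V_face_def)
  moreover have "q x \<bullet> ?w x = q x \<bullet> g x" for x
    using V_face_tangential[OF f q] normal_unit[OF f] by (simp add: cross3_triple inner_diff_right)
  ultimately show ?thesis
    by (simp add: L2_inner_def)
qed

lemma curl_bubble_orthogonal:
  assumes q: "q \<in> bubble_coeffs k" and g: "g \<in> poly_vec (k - 1)"
  shows "integral (Kbox c h) (\<lambda>x. curl_bubble q x \<bullet> g x) = 0"
proof -
  have rq: "poly_field (q f)" if "f \<in> faces" for f
    using poly_field_bubble_coeffs[OF q that] .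
  have rg: "poly_field (curl g)"
    by (intro poly_field_curl poly_vec_imp_poly_field[OF g])
  have "integral (Kbox c h) (\<lambda>x. curl_bubble q x \<bullet> g x)
      = integral (Kbox c h) (\<lambda>x. bubble_K c h x * (face_bubble_sum q x \<bullet> curl g x))"
    unfolding curl_bubble_def
    by (rule integral_curl_bubble_by_parts[OF rpf_face_bubble_sum[OF q] poly_vec_imp_poly_field[OF g]])
  also have "\<dots> = integral (Kbox c h) (\<lambda>x. \<Sum>f\<in>faces. bubble_K c h x * bubble_face c h f x * (q f x \<bullet> curl g x))"
    by (simp add: face_bubble_sum_def inner_sum_left sum_distrib_left mult.assoc)
  also have "\<dots> = (\<Sum>f\<in>faces. integral (Kbox c h) (\<lambda>x. bubble_K c h x * bubble_face c h f x * (q f x \<bullet> curl g x)))"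
    using poly_field_inner[OF rq rg] rpf_bubble_K rpf_bubble_face
    by (intro Henstock_Kurzweil_Integration.integral_sum finite_faces integrable_Kbox rpf_rules)
  also have "\<dots> = 0"
    using V_face_orthogonal[OF _ bubble_coeffsD[OF q] poly_vec_curl[OF g]] by (intro sum.neutral) auto
  finally show ?thesis .
qed

lemma poly_field_zero_on_Kbox:
  assumes w: "poly_field w" and 0: "integral (Kbox c h) (\<lambda>x. (bubble_K c h x)\<^sup>2 * (w x \<bullet> w x)) = 0"
  shows "w x = 0"
proof -
  have "real_polynomial_function (\<lambda>x. (bubble_K c h x)\<^sup>2 * (w x \<bullet> w x))"
    by (intro rpf_rules rpf_bubble_K poly_field_inner w)
  from zero_on_Kbox[OF this _ 0]
  have K0: "w x = 0" if "x \<in> Kbox c h" for x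
    using that bubble_K_pos[OF that] by fastforce
  have "w x $ i = 0" for i
    by (rule polynomial_zero_on_Kbox[OF poly_fieldD[OF w]]) (simp add: K0)
  then show ?thesis by (simp add: vec_eq_iff)
qed

text \<open>A trace zero means \<open>q = \<lambda>\<^sub>f w\<close> up to sign with \<open>w\<close> tangential of degree \<open>k - 1\<close>. Since
  \<open>\<lambda>\<^sub>f B\<^sub>f = B\<^sub>K\<close>, orthogonality to \<open>B\<^sub>K B\<^sub>f w\<close> says that the integral of \<open>B\<^sub>K\<^sup>2 |w|\<^sup>2\<close> is zero.\<close>

lemma V_face_trace_inj:
  assumes f: "f \<in> faces" and q: "q \<in> V_face c h k f"
    and 0: "\<And>x. q (slice (fst f) (plane f) x) = 0"
  shows "q = 0"
proof -
  have "\<exists>g. g \<in> poly_le (k - 1) \<and> (\<forall>x. q x $ j = (x $ fst f - plane f) * g x)" for j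
    using poly_le_divide_slice[of "\<lambda>x. q x $ j" k "fst f" "plane f"] V_face_poly_vec[OF f q] 0
    by (auto simp: poly_vec_def)
  then obtain g where g: "\<And>j. g j \<in> poly_le (k - 1)" "\<And>j x. q x $ j = (x $ fst f - plane f) * g j x"
    by metis
  define G where "G x = (\<chi> j. g j x)" for x
  have G: "G \<in> poly_vec (k - 1)" "q x = (x $ fst f - plane f) *\<^sub>R G x" for x
    using g by (auto simp: poly_vec_def G_def vec_eq_iff)
  define w where "w x = cross3 (cross3 (normal f) (G x)) (normal f)" for x
  have w: "w \<in> poly_vec_cross (k - 1) (normal f)"
    unfolding w_def[abs_def] by (rule tangential_part_in_poly_vec_cross[OF G(1)])
  have wv: "w \<in> poly_vec (k - 1)" "w x \<bullet> normal f = 0" for x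
    using w poly_vec_cross_iff[OF f] by auto
  have qw: "q x = (x $ fst f - plane f) *\<^sub>R w x" for x
  proof -
    have "q x = cross3 (cross3 (normal f) (q x)) (normal f)"
      using normal_unit[OF f] V_face_tangential[OF f q] by (simp add: cross3_triple inner_commute)
    then show ?thesis by (simp add: G(2) w_def cross_mult_left cross_mult_right)
  qed
  have "bubble_K c h x * bubble_face c h f x * (q x \<bullet> w x) = - snd f * ((bubble_K c h x)\<^sup>2 * (w x \<bullet> w x))" for x
  proof -
    have "snd f * bubble_K c h x = - ((snd f * snd f) * ((x $ fst f - plane f) * bubble_face c h f x))"
      unfolding bubble_K_eq_face_factor_mult_bubble_face[OF f] face_factor_eq[OF f] by simp
    then have "bubble_face c h f x * (x $ fst f - plane f) = - snd f * bubble_K c h x"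
      by (simp add: faces_snd[OF f] mult.commute)
    then show ?thesis
      by (simp add: qw power2_eq_square mult.assoc) (simp add: mult.assoc[symmetric])
  qed
  with V_face_orthogonal[OF f q wv(1)] faces_snd[OF f]
  have "integral (Kbox c h) (\<lambda>x. (bubble_K c h x)\<^sup>2 * (w x \<bullet> w x)) = 0"
    by auto
  then have "w x = 0" for x
    by (rule poly_field_zero_on_Kbox[OF poly_vec_imp_poly_field[OF wv(1)]])
  then show ?thesis by (simp add: fun_eq_iff qw)
qed

text \<open>The tangential trace on \<open>f\<close> is \<open>- B\<^sub>f\<^sup>2 q\<^sub>f\<close>; testing with minus the trace of \<open>q\<^sub>f\<close> gives the
  integral of a nonnegative function.\<close>

lemma tangential_dofs_zero_imp_bubble_zero:
  assumes q: "q \<in> bubble_coeffs k"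
    and dof: "\<And>f p. f \<in> faces \<Longrightarrow> p \<in> poly_face_tangential k f \<Longrightarrow>
      face_integral c h f (\<lambda>x. cross3 (curl_bubble q x) (normal f) \<bullet> p x) = 0"
  shows "q = 0"
proof
  fix f
  show "q f = 0 f"
  proof (cases "f \<in> faces")
    case f: True
    note V = bubble_coeffsD[OF q f]
    let ?sl = "slice (fst f) (plane f)"
    have rq: "poly_field (q f)"
      by (rule poly_vec_imp_poly_field[OF V_face_poly_vec[OF f V]])
    have tr: "(\<lambda>x. - q f (?sl x)) \<in> poly_face_tangential k f"
      using V_face_poly_vec[OF f V] V_face_tangential[OF f V]
      by (auto simp: poly_face_tangential_def poly_face_def poly_vec_def
          intro!: poly_le_closed poly_le_slice[where p = "\<lambda>x. q f x $ j" for j]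
            indep_of_slice[where p = "\<lambda>x. - q f x $ j" for j])
    have "0 = face_integral c h f (\<lambda>x. cross3 (curl_bubble q x) (normal f) \<bullet> - q f (?sl x))"
      using dof[OF f tr] by simp
    also have "\<dots> = face_integral c h f (\<lambda>x. (bubble_face c h f x)\<^sup>2 * (q f x \<bullet> q f x))"
    proof (rule face_integral_cong[OF f])
      fix x assume "x \<in> face_set c h f"
      then have "x $ fst f = plane f" by (rule face_setD[OF f])
      then show "cross3 (curl_bubble q x) (normal f) \<bullet> - q f (?sl x) = (bubble_face c h f x)\<^sup>2 * (q f x \<bullet> q f x)"
        by (simp add: curl_bubble_tangential_trace[OF f q] slice_same)
    qed
    finally have I: "face_integral c h f (\<lambda>x. (bubble_face c h f x)\<^sup>2 * (q f x \<bullet> q f x)) = 0" by simp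
    have z: "(bubble_face c h f x)\<^sup>2 * (q f x \<bullet> q f x) = 0" if "x \<in> face_set c h f" for x
      by (rule zero_on_face[OF f _ _ I that]) (auto intro!: rpf_rules poly_field_inner rq)
    have K0: "q f (?sl x) = 0" if "x \<in> Kbox c h" for x
      using z[OF slice_plane_in_face_set[OF f that]] bubble_face_pos[OF f that] by simp
    have "q f (?sl x) $ j = 0" for x j
      by (rule polynomial_zero_on_Kbox[OF rpf_slice[OF poly_fieldD[OF rq]]]) (simp add: K0)
    then have "q f = 0"
      by (intro V_face_trace_inj[OF f V]) (simp add: vec_eq_iff)
    then show ?thesis by simp
  next
    case False
    then show ?thesis using q by (cases f) (simp add: bubble_coeffs_def prod_space_def)
  qed
qed

end

section \<open>Dimensions\<close>

lemma fin_dim_poly_le: "fin_dim (poly_le k)"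
proof -
  have "{a :: 3 \<Rightarrow> nat. int (sum a UNIV) \<le> k} \<subseteq> (\<Pi>\<^sub>E i\<in>UNIV. {..nat k})"
  proof
    fix a :: "3 \<Rightarrow> nat" assume "a \<in> {a. int (sum a UNIV) \<le> k}"
    moreover have "a i \<le> sum a UNIV" for i by (rule member_le_sum) auto
    ultimately show "a \<in> (\<Pi>\<^sub>E i\<in>UNIV. {..nat k})"
      by (auto simp: PiE_iff simp del: of_nat_sum) (meson le_nat_iff order_trans of_nat_0_le_iff of_nat_mono)
  qed
  then have "finite {a :: 3 \<Rightarrow> nat. int (sum a UNIV) \<le> k}"
    by (rule finite_subset) (simp add: finite_PiE)
  then have "finite {monomial a | a. int (sum a UNIV) \<le> k}"
    by (simp add: setcompr_eq_image)
  then show ?thesis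
    unfolding fin_dim_def poly_le_def by blast
qed

definition poly_le_indep :: "int \<Rightarrow> 3 \<Rightarrow> (real^3 \<Rightarrow> real) set"
  where "poly_le_indep k i = {p \<in> poly_le k. indep_of i p}"

definition poly_hom_indep :: "int \<Rightarrow> 3 \<Rightarrow> (real^3 \<Rightarrow> real) set"
  where "poly_hom_indep k i = {p \<in> poly_hom k. indep_of i p}"

lemma subspace_indep_of: "subspace {p. indep_of i p}"
proof (rule subspaceI)
  show "p + q \<in> {p. indep_of i p}" if "p \<in> {p. indep_of i p}" "q \<in> {p. indep_of i p}" for p q
    using that unfolding mem_Collect_eq indep_of_iff_slice plus_fun_apply by simp
  show "a *\<^sub>R p \<in> {p. indep_of i p}" if "p \<in> {p. indep_of i p}" for a p
    using that unfolding mem_Collect_eq indep_of_iff_slice by simp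
qed (simp add: indep_of_def)

lemma fin_dim_poly_le_indep: "fin_dim (poly_le_indep k i)"
proof (rule fin_dim_subset[OF fin_dim_poly_le[of k]])
  have "poly_le_indep k i = poly_le k \<inter> {p. indep_of i p}"
    by (auto simp: poly_le_indep_def)
  then show "subspace (poly_le_indep k i)"
    using subspace_inter[OF subspace_poly_le subspace_indep_of] by simp
qed (auto simp: poly_le_indep_def)

lemma fin_dim_poly_hom_indep: "fin_dim (poly_hom_indep k i)"
proof (rule fin_dim_subset[OF fin_dim_poly_le[of k]])
  have "poly_hom_indep k i = poly_hom k \<inter> {p. indep_of i p}"
    by (auto simp: poly_hom_indep_def)
  then show "subspace (poly_hom_indep k i)"
    using subspace_inter[OF subspace_poly_hom subspace_indep_of] by simp
qed (auto simp: poly_hom_indep_def poly_hom_le)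

text \<open>Away from the plane \<open>x $ i = 0\<close> one can divide; the open half space \<open>x $ i > 0\<close> suffices.\<close>

lemma coord_mult_zero_imp_zero:
  assumes "g \<in> poly_le k" "\<And>x. x $ i * g x = 0"
  shows "g = 0"
proof
  fix x
  show "g x = 0 x"
    using polynomial_zero_on_open[OF poly_le_imp_real_polynomial_function[OF assms(1)],
        of "{x. 0 < x $ i}" "axis i 1" x] assms(2)
    by (force intro: open_Collect_less continuous_intros)
qed

text \<open>The splitting \<open>p = p(x\<^sub>i = 0) + x\<^sub>i g\<close> is direct, as the first summand is recovered by setting
  \<open>x\<^sub>i = 0\<close>.\<close>

lemma dim_poly_le: "dim (poly_le k) = dim (poly_le_indep k i) + dim (poly_le (k - 1))"
proof -
  define X where "X g = (\<lambda>x. x $ i * g x)" for g :: "real^3 \<Rightarrow> real"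
  have lin: "X (f + g) = X f + X g" "X (a *\<^sub>R g) = a *\<^sub>R X g" for f g a
    by (simp_all add: X_def fun_eq_iff algebra_simps)
  have inj: "g = 0" if "g \<in> poly_le (k - 1)" "X g = 0" for g
    using coord_mult_zero_imp_zero[OF that(1), of i] that(2) by (simp add: X_def fun_eq_iff)
  have X: "fin_dim (X ` poly_le (k - 1))" "dim (X ` poly_le (k - 1)) = dim (poly_le (k - 1))"
    by (rule dim_image_inj_on_subspace[OF fin_dim_poly_le lin inj]; assumption)+
  have "poly_le_indep k i \<inter> X ` poly_le (k - 1) \<subseteq> {0}"
  proof
    fix p assume p: "p \<in> poly_le_indep k i \<inter> X ` poly_le (k - 1)"
    then have "p (slice i 0 x) = p x" for x
      by (auto simp: poly_le_indep_def indep_of_iff_slice)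
    moreover have "p (slice i 0 x) = 0" for x
      using p by (auto simp: X_def)
    ultimately show "p \<in> {0}" by (simp add: fun_eq_iff)
  qed
  note sum = dim_direct_sum(2)[OF fin_dim_poly_le_indep X(1) this]
  have eq: "{a + b | a b. a \<in> poly_le_indep k i \<and> b \<in> X ` poly_le (k - 1)} = poly_le k"
  proof (intro equalityI subsetI)
    fix p assume "p \<in> {a + b | a b. a \<in> poly_le_indep k i \<and> b \<in> X ` poly_le (k - 1)}"
    then show "p \<in> poly_le k"
      by (auto simp: plus_fun_eq poly_le_indep_def X_def intro!: poly_le_closed coord_mult_poly_le)
  next
    fix p assume p: "p \<in> poly_le k"
    obtain g where g: "g \<in> poly_le (k - 1)" "\<And>x. p x = p (slice i 0 x) + x $ i * g x"
      using poly_le_divide_slice[OF p, of i 0] by auto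
    have "p = (\<lambda>x. p (slice i 0 x)) + X g"
      unfolding fun_eq_iff X_def plus_fun_apply by (intro allI g(2))
    moreover have "(\<lambda>x. p (slice i 0 x)) \<in> poly_le_indep k i"
      using p by (simp add: poly_le_indep_def indep_of_slice poly_le_slice)
    ultimately show "p \<in> {a + b | a b. a \<in> poly_le_indep k i \<and> b \<in> X ` poly_le (k - 1)}"
      using g(1) by blast
  qed
  show ?thesis using sum unfolding eq X(2) .
qed

text \<open>Splitting off the part of top degree, which inherits independence of \<open>x\<^sub>i\<close> by setting \<open>x\<^sub>i = 0\<close>.\<close>

lemma dim_poly_le_indep: "dim (poly_le_indep k i) = dim (poly_le_indep (k - 1) i) + dim (poly_hom_indep k i)"
proof -
  have "poly_le_indep (k - 1) i \<inter> poly_hom_indep k i \<subseteq> {0}"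
    using poly_hom_inter_poly_le by (auto simp: poly_le_indep_def poly_hom_indep_def)
  note sum = dim_direct_sum(2)[OF fin_dim_poly_le_indep fin_dim_poly_hom_indep this]
  have "{a + b | a b. a \<in> poly_le_indep (k - 1) i \<and> b \<in> poly_hom_indep k i} = poly_le_indep k i"
  proof (intro equalityI subsetI)
    fix p assume "p \<in> {a + b | a b. a \<in> poly_le_indep (k - 1) i \<and> b \<in> poly_hom_indep k i}"
    then obtain a b where ab: "p = a + b" "a \<in> poly_le (k - 1)" "indep_of i a" "b \<in> poly_hom k" "indep_of i b"
      by (auto simp: poly_le_indep_def poly_hom_indep_def)
    have "a \<in> poly_le k" "b \<in> poly_le k"
      using poly_le_mono[OF ab(2), of k] poly_hom_le[OF ab(4)] by simp_all
    then show "p \<in> poly_le_indep k i"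
      using ab(3,5) by (simp add: ab(1) plus_fun_eq poly_le_indep_def indep_of_iff_slice poly_le_closed)
  next
    fix p assume p: "p \<in> poly_le_indep k i"
    obtain q r where qr: "q \<in> poly_le (k - 1)" "r \<in> poly_hom k" "\<And>x. p x = q x + r x"
      using poly_le_decompose[of p k] p by (auto simp: poly_le_indep_def)
    have "p = (\<lambda>x. q (slice i 0 x)) + (\<lambda>x. r (slice i 0 x))"
      using p qr(3)[of "slice i 0 x" for x] by (simp add: fun_eq_iff poly_le_indep_def indep_of_iff_slice)
    moreover have "(\<lambda>x. q (slice i 0 x)) \<in> poly_le_indep (k - 1) i" "(\<lambda>x. r (slice i 0 x)) \<in> poly_hom_indep k i"
      by (simp_all add: qr(1,2) poly_le_indep_def poly_hom_indep_def indep_of_slice poly_le_slice poly_hom_slice_0)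
    ultimately show "p \<in> {a + b | a b. a \<in> poly_le_indep (k - 1) i \<and> b \<in> poly_hom_indep k i}"
      by blast
  qed
  then show ?thesis using sum by simp
qed

text \<open>This is the count for one coordinate direction: on the left the component \<open>p\<^sub>i\<close> and the form \<open>w\<^sub>i\<close> that parametrize the
  serendipity space, on the right the normal moments on the two faces orthogonal to direction \<open>i\<close> and component \<open>i\<close> of
  the interior moments.\<close>

lemma dim_poly_le_add_hom:
  "dim (poly_le m) + dim (poly_hom_indep m i) = 2 * dim (poly_le_indep m i) + dim (poly_le (m - 2))"
proof -
  have "m - 1 - 1 = m - 2" by simp
  then show ?thesis
    using dim_poly_le[of m i] dim_poly_le[of "m - 1" i] dim_poly_le_indep[of m i] by presburger
qed

lemma dim_poly_vec: "fin_dim (poly_vec k)" "dim (poly_vec k) = (\<Sum>i\<in>(UNIV :: 3 set). dim (poly_le k))"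
proof -
  define T where "T q = (\<lambda>x. \<chi> i. q i x)" for q :: "3 \<Rightarrow> real^3 \<Rightarrow> real"
  let ?P = "prod_space UNIV (\<lambda>i::3. poly_le k)"
  have P: "fin_dim ?P" "dim ?P = (\<Sum>i\<in>(UNIV :: 3 set). dim (poly_le k))"
    using dim_prod_space[of UNIV "\<lambda>i::3. poly_le k"] fin_dim_poly_le by auto
  have T: "fin_dim (T ` ?P)" "dim (T ` ?P) = dim ?P"
    by (rule dim_image_inj_on_subspace[OF P(1)]; simp add: T_def fun_eq_iff vec_eq_iff)+
  have "T ` ?P = poly_vec k"
  proof (intro equalityI subsetI)
    fix p assume "p \<in> poly_vec k"
    then have "(\<lambda>i x. p x $ i) \<in> ?P" "p = T (\<lambda>i x. p x $ i)"
      by (auto simp: poly_vec_def prod_space_def T_def)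
    then show "p \<in> T ` ?P" by blast
  qed (auto simp: poly_vec_def prod_space_def T_def)
  then show "fin_dim (poly_vec k)" "dim (poly_vec k) = (\<Sum>i\<in>(UNIV :: 3 set). dim (poly_le k))"
    using T P by auto
qed

lemma sum_dim_poly_face: "(\<Sum>f\<in>faces. dim (poly_face m f)) = (\<Sum>i\<in>UNIV. 2 * dim (poly_le_indep m i))"
proof -
  have "(\<Sum>f\<in>faces. dim (poly_face m f)) = (\<Sum>i\<in>UNIV. \<Sum>s\<in>{-1, 1 :: real}. dim (poly_face m (i, s)))"
    unfolding sum.cartesian_product faces_def by (simp add: split_def)
  also have "\<dots> = (\<Sum>i\<in>UNIV. 2 * dim (poly_le_indep m i))"
    by (simp add: poly_face_def poly_le_indep_def mult_2)
  finally show ?thesis .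
qed

lemma dim_hom_triples: "fin_dim (hom_triples m)" "dim (hom_triples m) = (\<Sum>i\<in>UNIV. dim (poly_hom_indep m i))"
proof -
  have "hom_triples m = prod_space UNIV (poly_hom_indep m)"
    by (simp add: hom_triples_def poly_hom_indep_def[abs_def])
  then show "fin_dim (hom_triples m)" "dim (hom_triples m) = (\<Sum>i\<in>UNIV. dim (poly_hom_indep m i))"
    using dim_prod_space[of UNIV "poly_hom_indep m"] fin_dim_poly_hom_indep by simp_all
qed

context box_domain
begin

lemma poly_vec_plus_serendipity_field_zero:
  assumes "p \<in> poly_vec m" "w \<in> hom_triples m" "1 \<le> m" "\<And>x. p x + serendipity_field m w x = 0"
  shows "w = 0"
  by (rule face_dofs_zero_imp_hom_zero[OF assms(1-3), of "\<lambda>x. 0"]) (simp_all add: assms(4) face_integral_def)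

lemma serendipity_field_linear:
  "serendipity_field m (v + w) = serendipity_field m v + serendipity_field m w" "serendipity_field m (a *\<^sub>R w) = a *\<^sub>R serendipity_field m w"
  by (simp_all add: fun_eq_iff vec_eq_iff serendipity_field_def serendipity_factor_def sum_3 algebra_simps)

lemma dim_S2:
  assumes m: "1 \<le> m"
  shows "fin_dim (S2 m)" "dim (S2 m) = (\<Sum>f\<in>faces. dim (poly_face m f)) + dim (poly_vec (m - 2))"
proof -
  have inj: "w = 0" if "w \<in> hom_triples m" "p \<in> poly_vec m" "p + serendipity_field m w = 0" for p w
    using poly_vec_plus_serendipity_field_zero[OF that(2,1) m] that(3) by (simp add: fun_eq_iff)
  have z: "0 \<in> poly_vec m" by (simp add: poly_vec_def poly_le_closed)
  have H: "fin_dim (serendipity_field m ` hom_triples m)" "dim (serendipity_field m ` hom_triples m) = dim (hom_triples m)"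
    by (rule dim_image_inj_on_subspace[OF dim_hom_triples(1)]; simp add: serendipity_field_linear inj[OF _ z])+
  have "poly_vec m \<inter> serendipity_field m ` hom_triples m \<subseteq> {0}"
  proof
    fix p assume p: "p \<in> poly_vec m \<inter> serendipity_field m ` hom_triples m"
    then obtain w where w: "w \<in> hom_triples m" "p = serendipity_field m w" by auto
    have "- w \<in> hom_triples m"
      using fin_dim_imp_subspace[OF dim_hom_triples(1)] w(1) by (rule subspace_neg)
    moreover have "p + serendipity_field m (- w) = 0"
      using serendipity_field_linear(1)[of m w "- w"] w by (simp add: serendipity_field_def serendipity_factor_def fun_eq_iff vec_eq_iff)
    ultimately have "- w = 0" using inj p by blast
    then show "p \<in> {0}" using w by (simp add: serendipity_field_def serendipity_factor_def fun_eq_iff vec_eq_iff)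
  qed
  note sum = dim_direct_sum[OF dim_poly_vec(1) H(1) this]
  have eq: "{a + b | a b. a \<in> poly_vec m \<and> b \<in> serendipity_field m ` hom_triples m} = S2 m"
    unfolding S2_eq by blast
  show "fin_dim (S2 m)" using sum(1) by (simp add: eq)
  have "dim (S2 m) = (\<Sum>i\<in>UNIV. dim (poly_le m) + dim (poly_hom_indep m i))"
    using sum(2) H(2) dim_hom_triples(2)[of m] dim_poly_vec(2)[of m] by (simp add: eq sum.distrib)
  also have "\<dots> = (\<Sum>f\<in>faces. dim (poly_face m f)) + dim (poly_vec (m - 2))"
    by (simp add: dim_poly_le_add_hom sum.distrib sum_dim_poly_face dim_poly_vec(2))
  finally show "dim (S2 m) = \<dots>" .
qed

lemma fin_dim_poly_vec_cross:
  assumes f: "f \<in> faces"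
  shows "fin_dim (poly_vec_cross k (normal f))"
proof (rule fin_dim_subset[OF dim_poly_vec(1)[of k]])
  show "subspace (poly_vec_cross k (normal f))"
    using subspace_add[OF fin_dim_imp_subspace[OF dim_poly_vec(1)[of k]]]
      subspace_scale[OF fin_dim_imp_subspace[OF dim_poly_vec(1)[of k]]]
      subspace_0[OF fin_dim_imp_subspace[OF dim_poly_vec(1)[of k]]]
    by (auto simp: subspace_def poly_vec_cross_iff[OF f] inner_add_left)
qed (auto simp: poly_vec_cross_iff[OF f])

lemma poly_field_poly_vec_cross: "f \<in> faces \<Longrightarrow> q \<in> poly_vec_cross k (normal f) \<Longrightarrow> poly_field q"
  using poly_vec_cross_iff[of f q k] poly_vec_imp_poly_field[of q k] by simp

lemma weighted_integral_add:
  assumes "real_polynomial_function b" "poly_field u" "poly_field v" "poly_field w"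
  shows "integral (Kbox c h) (\<lambda>x. b x * ((u x + v x) \<bullet> w x))
      = integral (Kbox c h) (\<lambda>x. b x * (u x \<bullet> w x)) + integral (Kbox c h) (\<lambda>x. b x * (v x \<bullet> w x))"
  unfolding inner_add_left distrib_left
  by (intro Henstock_Kurzweil_Integration.integral_add integrable_Kbox rpf_rules poly_field_inner assms)

lemma L2_inner_weighted: "L2_inner c h u (\<lambda>x. b x *\<^sub>R w x) = integral (Kbox c h) (\<lambda>x. b x * (u x \<bullet> w x))"
  by (simp add: L2_inner_def)

lemma fin_dim_V_face:
  assumes f: "f \<in> faces"
  shows "fin_dim (V_face c h k f)"
proof (rule fin_dim_subset[OF fin_dim_poly_vec_cross[OF f, of k]])
  note rpf = poly_field_poly_vec_cross[OF f]
  have rb: "real_polynomial_function (\<lambda>x. bubble_K c h x * bubble_face c h f x)"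
    by (intro rpf_rules rpf_bubble_K rpf_bubble_face)
  show "subspace (V_face c h k f)"
  proof (rule subspaceI)
    note sub = fin_dim_imp_subspace[OF fin_dim_poly_vec_cross[OF f, of k]]
    show "0 \<in> V_face c h k f"
      using subspace_0[OF sub] by (simp add: V_face_def L2_inner_weighted)
    show "p + q \<in> V_face c h k f" if "p \<in> V_face c h k f" "q \<in> V_face c h k f" for p q
      using that subspace_add[OF sub]
      by (simp add: V_face_def L2_inner_weighted weighted_integral_add[OF rb] rpf[of _ k] rpf[of _ "k - 1"])
    show "a *\<^sub>R q \<in> V_face c h k f" if "q \<in> V_face c h k f" for a q
      using that subspace_scale[OF sub] by (simp add: V_face_def L2_inner_weighted mult.left_commute[of _ a])
  qed
qed (auto simp: V_face_def)

text \<open>Extend \<open>p\<close> constantly in the normal direction and subtract \<open>\<lambda>\<^sub>f w\<close>, which does not affect the trace. As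
  \<open>B\<^sub>K B\<^sub>f \<lambda>\<^sub>f = B\<^sub>K\<^sup>2\<close>, the orthogonality conditions say that \<open>w\<close> represents a given functional with respect to
  the inner product with weight \<open>B\<^sub>K\<^sup>2\<close>.\<close>

lemma V_face_trace_surj:
  assumes f: "f \<in> faces" and p: "p \<in> poly_face_tangential k f"
  obtains q where "q \<in> V_face c h k f" "(\<lambda>x. q (slice (fst f) (plane f) x)) = p"
proof -
  let ?W = "poly_vec_cross (k - 1) (normal f)"
  have pc: "p \<in> poly_vec_cross k (normal f)"
    using p by (simp add: poly_vec_cross_iff[OF f] poly_face_tangential_def poly_face_def poly_vec_def)
  note rpf = poly_field_poly_vec_cross[OF f]
  define b where "b x = bubble_K c h x * bubble_face c h f x" for x
  define B where "B x = (bubble_K c h x)\<^sup>2" for x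
  have rb: "real_polynomial_function b" "real_polynomial_function B"
    unfolding b_def B_def by (intro rpf_rules rpf_bubble_K rpf_bubble_face)+
  have B_b: "B x = b x * face_factor c h f x" for x
    using bubble_K_eq_face_factor_mult_bubble_face[OF f, of c h x] by (simp add: B_def b_def power2_eq_square)
  obtain w where w: "w \<in> ?W"
    "\<And>v. v \<in> ?W \<Longrightarrow> integral (Kbox c h) (\<lambda>x. B x * (w x \<bullet> v x)) = integral (Kbox c h) (\<lambda>x. b x * (v x \<bullet> p x))"
  proof (rule bilinear_representation[OF fin_dim_poly_vec_cross[OF f, of "k - 1"],
        where \<beta> = "\<lambda>w v. integral (Kbox c h) (\<lambda>x. B x * (w x \<bullet> v x))"
          and \<phi> = "\<lambda>v. integral (Kbox c h) (\<lambda>x. b x * (v x \<bullet> p x))"])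
    show "integral (Kbox c h) (\<lambda>x. b x * ((u + v) x \<bullet> p x)) =
        integral (Kbox c h) (\<lambda>x. b x * (u x \<bullet> p x)) + integral (Kbox c h) (\<lambda>x. b x * (v x \<bullet> p x))"
      if "u \<in> ?W" "v \<in> ?W" for u v
      using weighted_integral_add[OF rb(1) rpf[OF that(1)] rpf[OF that(2)] rpf[OF pc]] by simp
    show "integral (Kbox c h) (\<lambda>x. b x * ((a *\<^sub>R u) x \<bullet> p x)) = a * integral (Kbox c h) (\<lambda>x. b x * (u x \<bullet> p x))"
      for a u
      by (simp add: mult.left_commute[of _ a])
    show "integral (Kbox c h) (\<lambda>x. B x * ((u + v) x \<bullet> w x)) =
        integral (Kbox c h) (\<lambda>x. B x * (u x \<bullet> w x)) + integral (Kbox c h) (\<lambda>x. B x * (v x \<bullet> w x))"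
      if "u \<in> ?W" "v \<in> ?W" "w \<in> ?W" for u v w
      using weighted_integral_add[OF rb(2) rpf[OF that(1)] rpf[OF that(2)] rpf[OF that(3)]] by simp
    show "integral (Kbox c h) (\<lambda>x. B x * ((a *\<^sub>R u) x \<bullet> w x)) = a * integral (Kbox c h) (\<lambda>x. B x * (u x \<bullet> w x))"
      for a u w
      by (simp add: mult.left_commute[of _ a])
    show "integral (Kbox c h) (\<lambda>x. B x * (u x \<bullet> w x)) = integral (Kbox c h) (\<lambda>x. B x * (w x \<bullet> u x))" for u w
      by (simp add: inner_commute)
    show "u = 0" if "u \<in> ?W" "integral (Kbox c h) (\<lambda>x. B x * (u x \<bullet> u x)) = 0" for u
    proof
      show "u x = 0 x" for x
        using poly_field_zero_on_Kbox[OF rpf[OF that(1)] that(2)[unfolded B_def], of x] by simp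
    qed
  qed (rule that)
  define q where "q x = p x - face_factor c h f x *\<^sub>R w x" for x
  have q_cross: "q \<in> poly_vec_cross k (normal f)"
  proof -
    have "(\<lambda>x. p x $ j - face_factor c h f x * w x $ j) \<in> poly_le k" for j
    proof -
      have wj: "(\<lambda>x. w x $ j) \<in> poly_le (k - 1)" and pj: "(\<lambda>x. p x $ j) \<in> poly_le k"
        using w(1) pc by (auto simp: poly_vec_cross_iff[OF f] poly_vec_def)
      have "(\<lambda>x. p x $ j - (- snd f * (x $ fst f * w x $ j) + snd f * plane f * w x $ j)) \<in> poly_le k"
        using wj pj poly_le_mono[OF wj, of k]
        by (intro poly_le_closed(2-4) coord_mult_poly_le) simp_all
      then show ?thesis by (simp add: face_factor_eq[OF f] algebra_simps)
    qed
    then show ?thesis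
      using pc w(1) by (simp add: poly_vec_cross_iff[OF f] poly_vec_def q_def inner_diff_left)
  qed
  have "q \<in> V_face c h k f"
    unfolding V_face_def mem_Collect_eq L2_inner_weighted b_def[symmetric]
  proof (intro conjI ballI q_cross)
    fix v assume v: "v \<in> ?W"
    have "integral (Kbox c h) (\<lambda>x. b x * (q x \<bullet> v x))
        = integral (Kbox c h) (\<lambda>x. b x * (v x \<bullet> p x) - B x * (w x \<bullet> v x))"
      by (simp add: q_def B_b inner_diff_left algebra_simps inner_commute)
    also have "\<dots> = 0"
      using w(2)[OF v] rpf[OF v] rpf[OF pc] rpf[OF w(1)] rb
      by (subst Henstock_Kurzweil_Integration.integral_diff) (auto intro!: integrable_Kbox rpf_rules poly_field_inner)
    finally show "integral (Kbox c h) (\<lambda>x. b x * (q x \<bullet> v x)) = 0" .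
  qed
  moreover have "(\<lambda>x. q (slice (fst f) (plane f) x)) = p"
  proof
    fix x
    have "p (slice (fst f) (plane f) x) = p x"
      using p indep_ofD[of "fst f" "\<lambda>x. p x $ j" "plane f" x for j]
      by (simp add: vec_eq_iff poly_face_tangential_def poly_face_def)
    then show "q (slice (fst f) (plane f) x) = p x"
      by (simp add: q_def face_factor_eq[OF f])
  qed
  ultimately show ?thesis using that by blast
qed

lemma dim_V_face:
  assumes f: "f \<in> faces"
  shows "dim (V_face c h k f) = dim (poly_face_tangential k f)"
proof -
  define T where "T q = (\<lambda>x. q (slice (fst f) (plane f) x))" for q :: "real^3 \<Rightarrow> real^3"
  have "dim (T ` V_face c h k f) = dim (V_face c h k f)"
  proof (rule dim_image_inj_on_subspace(2)[OF fin_dim_V_face[OF f]])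
    show "q = 0" if "q \<in> V_face c h k f" "T q = 0" for q
      using V_face_trace_inj[OF f that(1)] that(2) by (simp add: T_def fun_eq_iff)
  qed (simp_all add: T_def fun_eq_iff)
  moreover have "T ` V_face c h k f = poly_face_tangential k f"
  proof (intro equalityI subsetI)
    fix p assume "p \<in> T ` V_face c h k f"
    then obtain q where q: "q \<in> V_face c h k f" "p = T q" by auto
    then show "p \<in> poly_face_tangential k f"
      using V_face_poly_vec[OF f q(1)] V_face_tangential[OF f q(1)]
      by (auto simp: T_def poly_face_tangential_def poly_face_def poly_vec_def
          intro!: poly_le_slice[where p = "\<lambda>x. q x $ j" for j] indep_of_slice[where p = "\<lambda>x. q x $ j" for j])
  next
    fix p assume "p \<in> poly_face_tangential k f"
    then show "p \<in> T ` V_face c h k f"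
      unfolding T_def using V_face_trace_surj[OF f] by (metis image_eqI)
  qed
  ultimately show ?thesis by simp
qed

lemma dim_U_space:
  "fin_dim (U_space c h k)" "dim (U_space c h k) = (\<Sum>f\<in>faces. dim (poly_face_tangential k f))"
proof -
  have P: "fin_dim (bubble_coeffs k)" "dim (bubble_coeffs k) = (\<Sum>f\<in>faces. dim (V_face c h k f))"
    using dim_prod_space[OF finite_faces fin_dim_V_face] by (auto simp: bubble_coeffs_def)
  have r: "poly_field (\<lambda>x. bubble_K c h x *\<^sub>R face_bubble_sum q x)" if "q \<in> bubble_coeffs k" for q
    by (intro poly_field_scaleR rpf_bubble_K rpf_face_bubble_sum[OF that])
  have add: "curl_bubble (p + q) = curl_bubble p + curl_bubble q"
    if "p \<in> bubble_coeffs k" "q \<in> bubble_coeffs k" for p q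
    using curl_add[OF r[OF that(1)] r[OF that(2)]]
    by (simp add: curl_bubble_def face_bubble_sum_def plus_fun_eq scaleR_add_right sum.distrib)
  have scale: "curl_bubble (a *\<^sub>R q) = a *\<^sub>R curl_bubble q" if "q \<in> bubble_coeffs k" for a q
    using curl_scale[OF r[OF that], of a]
    by (simp add: curl_bubble_def face_bubble_sum_def scaleR_fun_def scaleR_sum_right mult.commute mult.left_commute)
  have inj: "q = 0" if "q \<in> bubble_coeffs k" "curl_bubble q = 0" for q
    by (rule tangential_dofs_zero_imp_bubble_zero[OF that(1)]) (simp add: that(2) face_integral_def)
  have "fin_dim (curl_bubble ` bubble_coeffs k)" "dim (curl_bubble ` bubble_coeffs k) = dim (bubble_coeffs k)"
    by (rule dim_image_inj_on_subspace[OF P(1) add scale inj]; assumption)+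
  then show "fin_dim (U_space c h k)" "dim (U_space c h k) = (\<Sum>f\<in>faces. dim (poly_face_tangential k f))"
    using P dim_V_face by (simp_all add: U_space_eq)
qed

definition dofs_vanish :: "int \<Rightarrow> (real^3 \<Rightarrow> real^3) \<Rightarrow> bool"
  where "dofs_vanish r u \<longleftrightarrow>
    (\<forall>f\<in>faces. \<forall>q\<in>poly_face (r - 1) f. face_integral c h f (\<lambda>x. (u x \<bullet> normal f) * q x) = 0) \<and>
    (\<forall>f\<in>faces. \<forall>q\<in>poly_face_tangential (r - 2) f. face_integral c h f (\<lambda>x. cross3 (u x) (normal f) \<bullet> q x) = 0) \<and>
    (\<forall>q\<in>poly_vec (r - 3). integral (Kbox c h) (\<lambda>x. u x \<bullet> q x) = 0)"

lemma poly_field_S2: "s \<in> S2 m \<Longrightarrow> poly_field s"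
proof -
  assume "s \<in> S2 m"
  then obtain p w where pw: "p \<in> poly_vec m" "w \<in> hom_triples m" "s = p + serendipity_field m w"
    by (auto simp: S2_eq)
  have "real_polynomial_function (serendipity_factor m w i)" for i
    using serendipity_factor_in_poly_hom[OF pw(2)] poly_hom_le poly_le_imp_real_polynomial_function by blast
  then show ?thesis
    using poly_fieldD[OF poly_vec_imp_poly_field[OF pw(1)]]
    by (simp add: poly_field_def pw(3) serendipity_field_def rpf_rules)
qed

text \<open>The two parts are treated one after the other: \<open>v\<close> does not contribute to the normal and interior
  degrees of freedom, and once \<open>s = 0\<close> the tangential ones see \<open>v\<close> alone.\<close>

lemma unisolvent:
  assumes r: "2 \<le> r" and s: "s \<in> S2 (r - 1)" and v: "v \<in> U_space c h (r - 2)"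
    and dofs: "dofs_vanish r (s + v)"
  shows "s = 0 \<and> v = 0"
proof -
  obtain p w where pw: "p \<in> poly_vec (r - 1)" "w \<in> hom_triples (r - 1)" "s = p + serendipity_field (r - 1) w"
    using s by (auto simp: S2_eq)
  obtain q where q: "q \<in> bubble_coeffs (r - 2)" "v = curl_bubble q"
    using v by (auto simp: U_space_eq)
  have rv: "poly_field v"
    unfolding q(2) curl_bubble_def
    by (intro poly_field_curl poly_field_scaleR rpf_bubble_K rpf_face_bubble_sum[OF q(1)])
  have "s x = 0" for x
  proof (rule serendipity_unisolvent[OF pw(1,2), where u = s])
    show "1 \<le> r - 1" using r by simp
    show "s x = p x + serendipity_field (r - 1) w x" for x by (simp add: pw(3))
    show "face_integral c h f (\<lambda>x. (s x \<bullet> normal f) * p x) = 0" if f: "f \<in> faces" and p: "p \<in> poly_face (r - 1) f" for f p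
    proof -
      have "face_integral c h f (\<lambda>x. (s x \<bullet> normal f) * p x) = face_integral c h f (\<lambda>x. ((s + v) x \<bullet> normal f) * p x)"
        using curl_bubble_normal_trace[OF f q(1) face_setD[OF f]]
        by (intro face_integral_cong[OF f]) (simp add: q(2) inner_add_left)
      then show ?thesis using dofs f p by (simp add: dofs_vanish_def)
    qed
    show "integral (Kbox c h) (\<lambda>x. s x \<bullet> p x) = 0" if p: "p \<in> poly_vec (r - 1 - 2)" for p
    proof -
      have p': "p \<in> poly_vec (r - 2 - 1)" "p \<in> poly_vec (r - 3)" using p by simp_all
      have "integral (Kbox c h) (\<lambda>x. (s + v) x \<bullet> p x)
          = integral (Kbox c h) (\<lambda>x. s x \<bullet> p x) + integral (Kbox c h) (\<lambda>x. v x \<bullet> p x)"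
        unfolding plus_fun_apply inner_add_left
        by (intro Henstock_Kurzweil_Integration.integral_add integrable_Kbox poly_field_inner
            poly_field_S2[OF s] rv poly_vec_imp_poly_field[OF p])
      then show ?thesis
        using dofs p'(2) curl_bubble_orthogonal[OF q(1) p'(1)] by (simp add: dofs_vanish_def q(2))
    qed
  qed
  then have s0: "s = 0" by (simp add: fun_eq_iff)
  have "q = 0"
    using dofs by (intro tangential_dofs_zero_imp_bubble_zero[OF q(1)]) (simp add: dofs_vanish_def s0 q(2))
  then have "v = curl_bubble (0 *\<^sub>R q)" using q(2) by simp
  then have "v = (\<lambda>x. 0 *\<^sub>R curl (\<lambda>x. bubble_K c h x *\<^sub>R face_bubble_sum q x) x)"
    using curl_scale[OF poly_field_scaleR[OF rpf_bubble_K rpf_face_bubble_sum[OF q(1)]], of 0]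
    by (simp add: curl_bubble_def face_bubble_sum_def)
  then show ?thesis using s0 by (simp add: fun_eq_iff)
qed

lemma dim_S2_plus:
  assumes r: "2 \<le> r"
  shows "dim (S2_plus c h (r - 1)) =
           (\<Sum>f\<in>faces. dim (poly_face (r - 1) f))
           + (\<Sum>f\<in>faces. dim (poly_face_tangential (r - 2) f))
           + dim (poly_vec (r - 3))"
proof -
  have "S2 (r - 1) \<inter> U_space c h (r - 2) \<subseteq> {0}"
  proof
    fix s assume s: "s \<in> S2 (r - 1) \<inter> U_space c h (r - 2)"
    then have "- s \<in> U_space c h (r - 2)"
      using subspace_neg[OF fin_dim_imp_subspace[OF dim_U_space(1)]] by blast
    moreover have "dofs_vanish r (s + - s)"
      by (simp add: dofs_vanish_def face_integral_def)
    ultimately show "s \<in> {0}" using unisolvent[OF r] s by blast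
  qed
  from dim_direct_sum(2)[OF dim_S2(1) dim_U_space(1) this]
  show ?thesis
    using r by (simp add: S2_plus_def dim_S2(2) dim_U_space(2))
qed

end

theorem theorem3p3:
  fixes r :: int and c h :: "real^3"
  assumes "2 \<le> r" and "\<forall>i. 0 < h $ i"
  shows "dim (S2_plus c h (r - 1)) =
           (\<Sum>f\<in>faces. dim (poly_face (r - 1) f))
           + (\<Sum>f\<in>faces. dim (poly_face_tangential (r - 2) f))
           + dim (poly_vec (r - 3))
       \<and> (\<forall>u \<in> S2_plus c h (r - 1).
           (\<forall>f\<in>faces. \<forall>q\<in>poly_face (r - 1) f.
              face_integral c h f (\<lambda>x. (u x \<bullet> normal f) * q x) = 0) \<and>
           (\<forall>f\<in>faces. \<forall>q\<in>poly_face_tangential (r - 2) f.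
              face_integral c h f (\<lambda>x. cross3 (u x) (normal f) \<bullet> q x) = 0) \<and>
           (\<forall>q\<in>poly_vec (r - 3). integral (Kbox c h) (\<lambda>x. u x \<bullet> q x) = 0)
           \<longrightarrow> u = 0)"
proof -
  interpret box_domain c h
    using assms(2) by unfold_locales simp
  have "u = 0" if u: "u \<in> S2_plus c h (r - 1)" and dofs: "dofs_vanish r u" for u
  proof -
    obtain s v where "s \<in> S2 (r - 1)" "v \<in> U_space c h (r - 2)" "u = s + v"
      using u by (auto simp: S2_plus_def)
    then show ?thesis using unisolvent[OF assms(1)] dofs by fastforce
  qed
  then show ?thesis
    using dim_S2_plus[OF assms(1)] unfolding dofs_vanish_def by blast
qed

end
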